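(* Let $\lambda\in\overline{\mathrm{Pr}}_k$. Then the simple highest weight module $L^{\mathfrak g}_{\mathfrak b}(\lambda)$ (with respect to the standard Borel subalgebra $\mathfrak b$) is a strongly tame $\Gamma_{\rm st}$-Gelfand–Tsetlin $\mathfrak g$-module. Moreover, for every $u\in\overline W$, the module $L^{\mathfrak g}_{u(\mathfrak b)}(u(\lambda))$ is a strongly tame $\Gamma_{\rm st}(u(\Pi_{\rm st}))$-Gelfand–Tsetlin $\mathfrak g$-module.
   Context: Let $\mathfrak g=\mathfrak{sl}_{n+1}(\mathbb C)$, $n\ge1$, $E_{i,j}$ matrix units, $\mathfrak h$ the traceless diagonal matrices, $\Delta_+=\{\varepsilon_i-\varepsilon_j:i<j\}$, $\Delta_-=-\Delta_+$, $\Pi_{\rm st}=(\alpha_1,\dots,\alpha_n)$, $\alpha_i=\varepsilon_i-\varepsilon_{i+1}$, $\mathfrak b$ the upper triangular Borel; $e_i=E_{i,i+1},f_i=E_{i+1,i},h_i=E_{ii}-E_{i+1,i+1}$. $(\cdot,\cdot)$ invariant form on $\mathfrak h^*$ with $(\alpha,\alpha)=2$ for roots; $\omega_i$ fundamental weights, $P^\vee=\bigoplus\mathbb Z\omega_i$, $\rho=\sum\omega_i$; $W$ the Weyl group, $w\cdot\mu=w(\mu+\rho)-\rho$. Admissible weights: fix $k\in\mathbb Q$, $k+n+1=p/q$, $p,q\in\mathbb N$ coprime, $p\ge n+1$; $\overline{\mathrm{Pr}}_{k,\mathbb Z}=\{\sum\lambda_i\omega_i:\lambda_i\in\mathbb N_0,\sum\lambda_i\le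 p-n-1\}$; for $w\in W$, $\eta\in P^\vee$, $C(w,\eta)$ means: for all $\alpha\in\Delta_+$, $0\le(\eta,\alpha)\le q-1$ if $w(\alpha)\in\Delta_+$, $1\le(\eta,\alpha)\le q$ if $w(\alpha)\in\Delta_-$; $\overline{\mathrm{Pr}}_k=\{w\cdot(\mu-\tfrac pq\eta):\mu\in\overline{\mathrm{Pr}}_{k,\mathbb Z},w\in W,\eta\in P^\vee,C(w,\eta)\}$. $\overline W\subset\mathrm{Aut}(\mathfrak g)$ is the group generated by $r_i=\exp(\mathrm{ad}f_i)\exp(-\mathrm{ad}e_i)\exp(\mathrm{ad}f_i)$ ($i=1,\dots,n$) and the involution $\sigma$ with $\sigma(e_i)=e_{n+1-i}$, $\sigma(f_i)=f_{n+1-i}$, $\sigma(h_i)=-h_{n+1-i}$. Elements of $\overline W$ preserve $\mathfrak h$ and so act on $\mathfrak h^*$, on roots, on bases (ordered sets of simple roots) and on Borel subalgebras containing $\mathfrak h$. For $u\in\overline W$ and a $\mathfrak g$-module $M$, $M^u$ is $M$ with action $a\cdot v=u^{-1}(a)v$. For a Borel $\mathfrak b'\supset\mathfrak h$, $L^{\mathfrak g}_{\mathfrak b'}(\mu)$ is the simple highest weight module of highest weight $\mu$ with respect to $\mathfrak b'$. A $\mathfrak g$-module $M$ is a strongly tame $\Gamma_{\rm st}$-Gelfand–Tsetlin module if it has a basis $\{T(v):v\in S\}$ indexed by a set $S$ of arrays $v=(v_{j,i})_{1\le i\le j\le n+1}$ of complex numbers such that for $k=1,\dots,n$: $e_k T(v)=-\sum_{i=1}^k\frac{\prod_{j=1}^{k+1}(v_{k,i}-v_{k+1,j})}{\prod_{j\ne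 i}(v_{k,i}-v_{k,j})}T(v+\delta^{k,i})$, $f_kT(v)=\sum_{i=1}^k\frac{\prod_{j=1}^{k-1}(v_{k,i}-v_{k-1,j})}{\prod_{j\ne i}(v_{k,i}-v_{k,j})}T(v-\delta^{k,i})$, $h_kT(v)=\big(2\sum_{i=1}^kv_{k,i}-\sum_{i=1}^{k-1}v_{k-1,i}-\sum_{i=1}^{k+1}v_{k+1,i}-1\big)T(v)$, where $\delta^{k,i}$ is the array with $1$ at position $(k,i)$ and $0$ elsewhere, summands with vanishing denominator are zero, and $T(w)$ for $w\notin S$ means $0$ (such a basis is an eigenbasis for the standard Gelfand–Tsetlin subalgebra $\Gamma_{\rm st}$ generated by the centers of $U(\mathfrak{gl}_m)$, $m\le n+1$). For a base $\Pi'$, $M$ is a strongly tame $\Gamma_{\rm st}(\Pi')$-Gelfand–Tsetlin module if there is $u\in\overline W$ with $\Pi'=u(\Pi_{\rm st})$ (as ordered sets) such that $M^{u^{-1}}$ is a strongly tame $\Gamma_{\rm st}$-Gelfand–Tsetlin module.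
   Formalization: The involution σ is taken to be the automorphism with σ(e_i)=e_{n+1-i}, σ(f_i)=f_{n+1-i}, hence σ(h_i)=h_{n+1-i}; the stated sign σ(h_i)=-h_{n+1-i} is impossible because h_i=[e_i,f_i]. *)

theory Defs
  imports Complex_Main "HOL-Combinatorics.Permutations"
begin

type_synonym mat = "nat \<Rightarrow> nat \<Rightarrow> complex"

definition idx :: "nat \<Rightarrow> nat set" where "idx n = {1..n+1}"

definition sl :: "nat \<Rightarrow> mat set" where
  "sl n = {X. (\<forall>a b. (a \<notin> idx n \<or> b \<notin> idx n) \<longrightarrow> X a b = 0) \<and> (\<Sum>a\<in>idx n. X a a) = 0}"

definition madd :: "mat \<Rightarrow> mat \<Rightarrow> mat" where "madd X Y = (\<lambda>a b. X a b + Y a b)"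
definition msmult :: "complex \<Rightarrow> mat \<Rightarrow> mat" where "msmult c X = (\<lambda>a b. c * X a b)"
definition mmul :: "nat \<Rightarrow> mat \<Rightarrow> mat \<Rightarrow> mat" where
  "mmul n X Y = (\<lambda>a b. \<Sum>c\<in>idx n. X a c * Y c b)"
definition bracket :: "nat \<Rightarrow> mat \<Rightarrow> mat \<Rightarrow> mat" where
  "bracket n X Y = (\<lambda>a b. mmul n X Y a b - mmul n Y X a b)"

definition Eu :: "nat \<Rightarrow> nat \<Rightarrow> mat" where "Eu i j = (\<lambda>a b. if a = i \<and> b = j then 1 else 0)"
definition ee :: "nat \<Rightarrow> mat" where "ee i = Eu i (i+1)"
definition ff :: "nat \<Rightarrow> mat" where "ff i = Eu (i+1) i"
definition hh :: "nat \<Rightarrow> mat" where "hh i = madd (Eu i i) (msmult (-1) (Eu (i+1) (i+1)))"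

definition cartan :: "nat \<Rightarrow> mat set" where
  "cartan n = {X \<in> sl n. \<forall>a b. a \<noteq> b \<longrightarrow> X a b = 0}"
definition nplus :: "nat \<Rightarrow> mat set" where
  "nplus n = {X \<in> sl n. \<forall>a b. b \<le> a \<longrightarrow> X a b = 0}"

definition lie_module :: "nat \<Rightarrow> (complex \<Rightarrow> 'v::ab_group_add \<Rightarrow> 'v) \<Rightarrow> (mat \<Rightarrow> 'v \<Rightarrow> 'v) \<Rightarrow> bool" where
  "lie_module n scale \<rho> \<longleftrightarrow> vector_space scale \<and>
     (\<forall>X\<in>sl n. Vector_Spaces.linear scale scale (\<rho> X)) \<and>
     (\<forall>X\<in>sl n. \<forall>Y\<in>sl n. \<forall>v. \<rho> (madd X Y) v = \<rho> X v + \<rho> Y v) \<and>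
     (\<forall>X\<in>sl n. \<forall>c v. \<rho> (msmult c X) v = scale c (\<rho> X v)) \<and>
     (\<forall>X\<in>sl n. \<forall>Y\<in>sl n. \<forall>v. \<rho> (bracket n X Y) v = \<rho> X (\<rho> Y v) - \<rho> Y (\<rho> X v))"

definition simple_module :: "nat \<Rightarrow> (complex \<Rightarrow> 'v::ab_group_add \<Rightarrow> 'v) \<Rightarrow> (mat \<Rightarrow> 'v \<Rightarrow> 'v) \<Rightarrow> bool" where
  "simple_module n scale \<rho> \<longleftrightarrow> lie_module n scale \<rho> \<and> (\<exists>v::'v. v \<noteq> 0) \<and>
     (\<forall>W. module.subspace scale W \<and> (\<forall>X\<in>sl n. \<forall>w\<in>W. \<rho> X w \<in> W) \<longrightarrow> W = {0} \<or> W = UNIV)"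

text \<open>Weights (elements of h^*) are represented as functionals on matrices (used on h).
  A simple g-module with a highest weight vector of weight mu for the Borel b' = h + N
  (N the nilradical of b') is (a realization of) L_{b'}(mu).\<close>
definition simple_hw_module :: "nat \<Rightarrow> (complex \<Rightarrow> 'v::ab_group_add \<Rightarrow> 'v) \<Rightarrow> (mat \<Rightarrow> 'v \<Rightarrow> 'v)
    \<Rightarrow> mat set \<Rightarrow> (mat \<Rightarrow> complex) \<Rightarrow> bool" where
  "simple_hw_module n scale \<rho> N \<mu> \<longleftrightarrow> simple_module n scale \<rho> \<and>
     (\<exists>v. v \<noteq> 0 \<and> (\<forall>X\<in>N. \<rho> X v = 0) \<and> (\<forall>H\<in>cartan n. \<rho> H v = scale (\<mu> H) v))"

text \<open>Weight with Dynkin labels c_1..c_n, i.e. sum c_i omega_i, as functional on h\<close>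
definition wt_fun :: "nat \<Rightarrow> (nat \<Rightarrow> complex) \<Rightarrow> mat \<Rightarrow> complex" where
  "wt_fun n c H = (\<Sum>i=1..n. c i * (\<Sum>j=1..i. H j j))"

definition alpha :: "nat \<Rightarrow> mat \<Rightarrow> complex" where "alpha i H = H i i - H (i+1) (i+1)"

definition eps_coords :: "nat \<Rightarrow> (nat \<Rightarrow> complex) \<Rightarrow> nat \<Rightarrow> complex" where
  "eps_coords n c a = (\<Sum>i=a..n. c i)"

text \<open>Weyl group element w given by a permutation s of {1..n+1}, w(eps_a) = eps_{s a}\<close>
definition weyl_act :: "nat \<Rightarrow> (nat \<Rightarrow> nat) \<Rightarrow> (nat \<Rightarrow> complex) \<Rightarrow> nat \<Rightarrow> complex" where
  "weyl_act n s c i = eps_coords n c (inv s i) - eps_coords n c (inv s (i+1))"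

definition dot_act :: "nat \<Rightarrow> (nat \<Rightarrow> nat) \<Rightarrow> (nat \<Rightarrow> complex) \<Rightarrow> nat \<Rightarrow> complex" where
  "dot_act n s c = (\<lambda>i. weyl_act n s (\<lambda>j. c j + 1) i - 1)"

text \<open>C(w,eta); (eta, eps_a - eps_b) = eta_a + ... + eta_{b-1} for eta = sum eta_l omega_l\<close>
definition condC :: "nat \<Rightarrow> nat \<Rightarrow> (nat \<Rightarrow> nat) \<Rightarrow> (nat \<Rightarrow> int) \<Rightarrow> bool" where
  "condC n q s \<eta> \<longleftrightarrow> (\<forall>a b. 1 \<le> a \<and> a < b \<and> b \<le> n+1 \<longrightarrow>
     (if s a < s b then 0 \<le> (\<Sum>l=a..<b. \<eta> l) \<and> (\<Sum>l=a..<b. \<eta> l) \<le> int q - 1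
      else 1 \<le> (\<Sum>l=a..<b. \<eta> l) \<and> (\<Sum>l=a..<b. \<eta> l) \<le> int q))"

definition admissible :: "nat \<Rightarrow> nat \<Rightarrow> nat \<Rightarrow> (nat \<Rightarrow> complex) \<Rightarrow> bool" where
  "admissible n p q c \<longleftrightarrow> (\<exists>(\<mu>::nat \<Rightarrow> nat) s (\<eta>::nat \<Rightarrow> int).
     (\<Sum>i=1..n. \<mu> i) + n + 1 \<le> p \<and> s permutes idx n \<and> condC n q s \<eta> \<and>
     (\<forall>i\<in>{1..n}. c i = dot_act n s (\<lambda>j. of_nat (\<mu> j) - (of_nat p / of_nat q) * of_int (\<eta> j)) i))"

definition ad :: "nat \<Rightarrow> mat \<Rightarrow> mat \<Rightarrow> mat" where "ad n A = bracket n A"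

text \<open>exp(ad A) for nilpotent A: ad A is nilpotent of order at most 2n+1, so the series is finite\<close>
definition expad :: "nat \<Rightarrow> mat \<Rightarrow> mat \<Rightarrow> mat" where
  "expad n A X = (\<lambda>a b. \<Sum>k\<le>2*n+2. ((ad n A ^^ k) X) a b / of_nat (fact k))"

definition refl_r :: "nat \<Rightarrow> nat \<Rightarrow> mat \<Rightarrow> mat" where
  "refl_r n i = expad n (ff i) \<circ> expad n (msmult (-1) (ee i)) \<circ> expad n (ff i)"

text \<open>the involution: the automorphism with e_i -> e_{n+1-i}, f_i -> f_{n+1-i}\<close>
definition sigma_inv :: "nat \<Rightarrow> mat \<Rightarrow> mat" where
  "sigma_inv n X = (\<lambda>c d. if c \<in> idx n \<and> d \<in> idx n
       then - ((-1) ^ (c + d)) * X (n + 2 - d) (n + 2 - c) else 0)"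

inductive_set Wbar :: "nat \<Rightarrow> (mat \<Rightarrow> mat) set" for n where
  Wbar_id: "id \<in> Wbar n"
| Wbar_r: "u \<in> Wbar n \<Longrightarrow> i \<in> {1..n} \<Longrightarrow> refl_r n i \<circ> u \<in> Wbar n"
| Wbar_sigma: "u \<in> Wbar n \<Longrightarrow> sigma_inv n \<circ> u \<in> Wbar n"

definition hstar_act :: "nat \<Rightarrow> (mat \<Rightarrow> mat) \<Rightarrow> (mat \<Rightarrow> complex) \<Rightarrow> mat \<Rightarrow> complex" where
  "hstar_act n u \<mu> H = \<mu> (the_inv_into (cartan n) u H)"

type_synonym gtarr = "nat \<Rightarrow> nat \<Rightarrow> complex"

definition gt_arrays :: "nat \<Rightarrow> gtarr set" where
  "gt_arrays n = {v. \<forall>j i. \<not> (1 \<le> i \<and> i \<le> j \<and> j \<le> n+1) \<longrightarrow> v j i = 0}"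

definition shift :: "gtarr \<Rightarrow> nat \<Rightarrow> nat \<Rightarrow> complex \<Rightarrow> gtarr" where
  "shift v k i t = v(k := (v k)(i := v k i + t))"

definition coefE :: "gtarr \<Rightarrow> nat \<Rightarrow> nat \<Rightarrow> complex" where
  "coefE v k i = (let d = (\<Prod>j\<in>{1..k}-{i}. v k i - v k j) in
     if d = 0 then 0 else (\<Prod>j=1..k+1. v k i - v (k+1) j) / d)"

definition coefF :: "gtarr \<Rightarrow> nat \<Rightarrow> nat \<Rightarrow> complex" where
  "coefF v k i = (let d = (\<Prod>j\<in>{1..k}-{i}. v k i - v k j) in
     if d = 0 then 0 else (\<Prod>j=1..k-1. v k i - v (k-1) j) / d)"

definition strongly_tame_GT :: "nat \<Rightarrow> (complex \<Rightarrow> 'v::ab_group_add \<Rightarrow> 'v) \<Rightarrow> (mat \<Rightarrow> 'v \<Rightarrow> 'v) \<Rightarrow> bool" where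
  "strongly_tame_GT n scale \<rho> \<longleftrightarrow> (\<exists>S (T :: gtarr \<Rightarrow> 'v).
     S \<subseteq> gt_arrays n \<and> inj_on T S \<and>
     \<not> module.dependent scale (T ` S) \<and> module.span scale (T ` S) = UNIV \<and>
     (let T0 = (\<lambda>w. if w \<in> S then T w else 0) in
      \<forall>k\<in>{1..n}. \<forall>v\<in>S.
        \<rho> (ee k) (T v) = - (\<Sum>i=1..k. scale (coefE v k i) (T0 (shift v k i 1))) \<and>
        \<rho> (ff k) (T v) = (\<Sum>i=1..k. scale (coefF v k i) (T0 (shift v k i (-1)))) \<and>
        \<rho> (hh k) (T v) = scale (2 * (\<Sum>i=1..k. v k i) - (\<Sum>i=1..k-1. v (k-1) i)
                                  - (\<Sum>i=1..k+1. v (k+1) i) - 1) (T v)))"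

text \<open>M is strongly tame Gamma_st(Pi')-GT if Pi' = u(Pi_st) (ordered) for some u in \<overline>W
  with M^{u^{-1}} (action a.v = u(a) v) strongly tame Gamma_st-GT.  Pi' is given as
  i \<mapsto> i-th simple root (functional on h), i = 1..n.\<close>
definition strongly_tame_GT_base :: "nat \<Rightarrow> (complex \<Rightarrow> 'v::ab_group_add \<Rightarrow> 'v) \<Rightarrow> (mat \<Rightarrow> 'v \<Rightarrow> 'v)
    \<Rightarrow> (nat \<Rightarrow> mat \<Rightarrow> complex) \<Rightarrow> bool" where
  "strongly_tame_GT_base n scale \<rho> Pi' \<longleftrightarrow> (\<exists>u\<in>Wbar n.
     (\<forall>i\<in>{1..n}. \<forall>H\<in>cartan n. Pi' i H = hstar_act n u (alpha i) H) \<and>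
     strongly_tame_GT n scale (\<lambda>X. \<rho> (u X)))"

end

theory Submission
  imports Defs "HOL-Computational_Algebra.Polynomial"
begin

text \<open>Write \<open>m = \<lambda> + \<rho>\<close> in \<open>\<epsilon>\<close>-coordinates. Admissibility makes \<open>m\<close> regular dominant: for
  \<open>i < j\<close> the difference \<open>m i - m j\<close> is either not an integer or a positive integer. Let \<open>S\<close> be the
  set of arrays with top row \<open>m\<close> whose \<open>i\<close>-th column lies in \<open>m i - \<nat>\<close> and in which columns with
  integral difference interlace. On the span of \<open>S\<close> the Gelfand--Tsetlin formulas define operators;
  \<open>[e\<^sub>k, f\<^sub>k] = h\<^sub>k\<close> is a sum of residues. The Serre relations need not be verified: a cyclic
  vector and a one-dimensional common kernel of the \<open>e\<^sub>k\<close> already make the span of \<open>S\<close> simple, and the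
  usual uniqueness argument for simple highest weight modules, applied to the submodule of the
  direct sum generated by the two highest weight vectors, uses only \<open>[e\<^sub>k, f\<^sub>l] = \<delta>\<^sub>k\<^sub>l h\<^sub>k\<close> and the
  weights of the \<open>f\<^sub>l\<close>. For the second part, \<open>u\<close> itself is the required witness, since twisting by
  an automorphism that preserves \<open>\<hh>\<close> reduces it to the first part.\<close>

section \<open>The residue identity\<close>

text \<open>One triangularity gives both the cyclic vector and the one-dimensional kernel. Call
  \<open>v\<close> aligned up to row \<open>k\<close> if the rows \<open>1..k\<close> repeat row
  \<open>k\<close> as far as they reach. Raising entry \<open>i\<close> of row \<open>k\<close> of
  such an array and lowering another entry \<open>j\<close> of that row always destroys alignment.
  Hence, when \<open>opF k\<close> is applied to the raised array, or \<open>opE k f\<close> is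
  evaluated at it, all terms but one belong to arrays already settled at a lower row, and the
  remaining coefficient is nonzero. Working upwards through the rows, the coefficients
  \<open>coefF\<close> yield cyclicity, while the coefficients \<open>coefE\<close> show that a
  vector killed by all \<open>opE k\<close> is supported on the highest array \<open>v0\<close>.

  The model is cut off at the boundary of \<open>S\<close>, and a term dropped there may have a
  nonzero coefficient. The relations survive because a move out of \<open>S\<close> and the move
  back have coefficients with product 0, and because two moves at different positions that lead from
  \<open>S\<close> to \<open>S\<close> can be exchanged inside \<open>S\<close>.\<close>

lemma degree_prod_linear:
  fixes c :: "'i \<Rightarrow> complex"
  assumes "finite J"
  shows "degree (\<Prod>j\<in>J. [:- c j, 1:]) = card J" "coeff (\<Prod>j\<in>J. [:- c j, 1:]) (card J) = 1"
proof -
  show d: "degree (\<Prod>j\<in>J. [:- c j, 1:]) = card J"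
    by (subst degree_prod_eq_sum_degree) auto
  have "lead_coeff (\<Prod>j\<in>J. [:- c j, 1:]) = 1"
    by (simp add: lead_coeff_prod)
  thus "coeff (\<Prod>j\<in>J. [:- c j, 1:]) (card J) = 1"
    using d by simp
qed

lemma subleading_coeff_prod_linear:
  fixes c :: "'i \<Rightarrow> complex"
  assumes "finite J" "card J = Suc d"
  shows "coeff (\<Prod>j\<in>J. [:- c j, 1:]) d = - (\<Sum>j\<in>J. c j)"
  using assms
proof (induction J arbitrary: d rule: finite_induct)
  case (insert x F)
  hence d: "d = card F" by simp
  have 1: "coeff (\<Prod>j\<in>F. [:- c j, 1:]) d = 1"
    using degree_prod_linear(2)[OF insert.hyps(1), of c] d by simp
  show ?case
  proof (cases d)
    case 0
    hence "F = {}" using insert.hyps d by simp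
    thus ?thesis using 0 by simp
  next
    case (Suc e)
    have "coeff (\<Prod>j\<in>F. [:- c j, 1:]) e = - (\<Sum>j\<in>F. c j)"
      using insert.IH[of e] d Suc by simp
    thus ?thesis using insert.hyps Suc 1 by (simp add: coeff_pCons)
  qed
qed simp

text \<open>A polynomial of degree below \<open>card I\<close> equals its own Lagrange interpolant
  \<open>q\<close>, and every basis polynomial \<open>B i\<close> is monic of degree
  \<open>card I - 1\<close>; comparing top coefficients gives the sum.\<close>

lemma lagrange_leading_coeff:
  fixes y :: "'i \<Rightarrow> complex"
  assumes fin: "finite I" and inj: "inj_on y I" and deg: "degree p < card I"
  shows "(\<Sum>i\<in>I. poly p (y i) / (\<Prod>j\<in>I - {i}. y i - y j)) = coeff p (card I - 1)"
proof -
  define D where "D i = (\<Prod>j\<in>I - {i}. y i - y j)" for i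
  define B where "B i = (\<Prod>j\<in>I - {i}. [:- y j, 1:])" for i
  have D0: "D i \<noteq> 0" if "i \<in> I" for i
    using fin inj that unfolding D_def by (auto simp: inj_on_def)
  have Bdeg: "degree (B i) = card I - 1" "coeff (B i) (card I - 1) = 1" if "i \<in> I" for i
    using degree_prod_linear[of "I - {i}" y] fin that by (auto simp: B_def)
  define q where "q = (\<Sum>i\<in>I. smult (poly p (y i) / D i) (B i))"
  have Bval: "poly (B i) (y j) = (if i = j then D i else 0)" if "i \<in> I" "j \<in> I" for i j
    using that fin by (auto simp: B_def D_def poly_prod)
  have "poly q (y j) = poly p (y j)" if "j \<in> I" for j
  proof -
    have "poly q (y j) = (\<Sum>i\<in>I. if i = j then poly p (y i) else 0)"
      unfolding q_def poly_sum using that D0 by (intro sum.cong) (auto simp: Bval)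
    thus ?thesis using that fin by simp
  qed
  moreover have "degree q < card I"
  proof -
    have "degree q \<le> card I - 1"
      unfolding q_def by (rule degree_sum_le[OF fin]) (use Bdeg degree_smult_le in fastforce)
    thus ?thesis using deg by linarith
  qed
  moreover have "card (y ` I) = card I" using inj by (rule card_image)
  ultimately have "p = q"
    using deg by (intro poly_eqI_degree[of "y ` I"]) auto
  hence "coeff p (card I - 1) = coeff q (card I - 1)" by simp
  also have "\<dots> = (\<Sum>i\<in>I. poly p (y i) / D i * coeff (B i) (card I - 1))"
    by (simp add: q_def coeff_sum)
  also have "\<dots> = (\<Sum>i\<in>I. poly p (y i) / D i)"
    by (rule sum.cong) (simp_all only: Bdeg mult_1_right)
  finally show ?thesis by (simp add: D_def)
qed

text \<open>The node polynomial vanishes at every \<open>y i\<close>, so subtracting it leaves the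
  numerators unchanged and cancels the leading term. The Lagrange formula then returns the
  difference of the subleading coefficients.\<close>

lemma sum_residues:
  fixes y :: "'i \<Rightarrow> complex" and c :: "'j \<Rightarrow> complex"
  assumes "finite I" "finite J" "inj_on y I" "card I = card J"
  shows "(\<Sum>i\<in>I. (\<Prod>j\<in>J. y i - c j) / (\<Prod>j\<in>I - {i}. y i - y j)) = (\<Sum>i\<in>I. y i) - (\<Sum>j\<in>J. c j)"
proof (cases "card I")
  case 0
  thus ?thesis using assms by (simp add: card_eq_0_iff)
next
  case (Suc d)
  define p where "p = (\<Prod>j\<in>J. [:- c j, 1:]) - (\<Prod>j\<in>I. [:- y j, 1:])"
  have "poly p (y i) = (\<Prod>j\<in>J. y i - c j)" if "i \<in> I" for i
    using that assms by (auto simp: p_def poly_prod)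
  hence "(\<Sum>i\<in>I. (\<Prod>j\<in>J. y i - c j) / (\<Prod>j\<in>I - {i}. y i - y j))
      = (\<Sum>i\<in>I. poly p (y i) / (\<Prod>j\<in>I - {i}. y i - y j))"
    by simp
  also have "\<dots> = coeff p (card I - 1)"
  proof (rule lagrange_leading_coeff[OF assms(1,3)])
    have le: "degree p \<le> card I"
      unfolding p_def by (rule degree_diff_le) (simp_all add: degree_prod_linear(1) assms(1,2) assms(4)[symmetric] del: prod_constant)
    have c0: "coeff p (card I) = 0"
      using degree_prod_linear(2)[OF assms(1), of y] degree_prod_linear(2)[OF assms(2), of c] assms(4)
      by (simp add: p_def)
    have "degree p \<noteq> card I"
    proof
      assume eq: "degree p = card I"
      hence "lead_coeff p = 0" using c0 by simp
      hence "p = 0" by simp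
      thus False using eq Suc by simp
    qed
    thus "degree p < card I" using le by simp
  qed
  also have "\<dots> = (\<Sum>i\<in>I. y i) - (\<Sum>j\<in>J. c j)"
    using subleading_coeff_prod_linear[OF assms(1), of d y] subleading_coeff_prod_linear[OF assms(2), of d c] assms(4)
    unfolding p_def Suc diff_Suc_1 coeff_diff by simp
  finally show ?thesis .
qed

text \<open>With \<open>a\<close>, \<open>x\<close>, \<open>b\<close> the rows \<open>k+1\<close>,
  \<open>k\<close>, \<open>k-1\<close> of an array, this is the contribution of position
  \<open>(k, i)\<close> to the diagonal coefficient of \<open>[e_k, f_k]\<close>: raising then
  lowering back, minus lowering then raising back. The order of the difference comes from the minus
  sign in the formula for \<open>e_k\<close>.\<close>

definition gt_commutator :: "nat \<Rightarrow> (nat \<Rightarrow> complex) \<Rightarrow> (nat \<Rightarrow> complex) \<Rightarrow> (nat \<Rightarrow> complex) \<Rightarrow> nat \<Rightarrow> complex" where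
  "gt_commutator k a b x i =
     (\<Prod>j=1..k+1. x i - a j) * (\<Prod>j=1..k-1. x i + 1 - b j) /
       ((\<Prod>j\<in>{1..k}-{i}. x i - x j) * (\<Prod>j\<in>{1..k}-{i}. x i + 1 - x j))
   - (\<Prod>j=1..k+1. x i - 1 - a j) * (\<Prod>j=1..k-1. x i - b j) /
       ((\<Prod>j\<in>{1..k}-{i}. x i - x j) * (\<Prod>j\<in>{1..k}-{i}. x i - 1 - x j))"

text \<open>The residue sum is taken over \<open>2k\<close> nodes: the \<open>x i\<close> produce
  the first terms and the \<open>x i - 1\<close> the second ones. The roots are the
  \<open>k+1\<close> numbers \<open>a j\<close> and the \<open>k-1\<close> numbers
  \<open>b j - 1\<close>. The factor joining \<open>x i\<close> to \<open>x i - 1\<close> is 1 or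
  -1, which supplies the sign, and the constant is \<open>- k + (k - 1)\<close>.\<close>

lemma sum_gt_commutator_generic:
  fixes x a b :: "nat \<Rightarrow> complex"
  assumes "k \<ge> 1" and inj: "\<And>i j. i \<in> {1..k} \<Longrightarrow> j \<in> {1..k} \<Longrightarrow> i \<noteq> j \<Longrightarrow> x i \<noteq> x j \<and> x i + 1 \<noteq> x j"
  shows "(\<Sum>i=1..k. gt_commutator k a b x i) = 2 * (\<Sum>i=1..k. x i) - (\<Sum>i=1..k-1. b i) - (\<Sum>i=1..k+1. a i) - 1"
proof -
  define I where "I = {1..k} <+> {1..k}"
  define J where "J = {1..k+1} <+> {1..k-1}"
  define y where "y = case_sum x (\<lambda>i. x i - 1)"
  define c where "c = case_sum a (\<lambda>i. b i - 1)"
  have fin: "finite I" "finite J" by (auto simp: I_def J_def)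
  have injy: "inj_on y I"
  proof (rule inj_onI)
    fix s t assume st: "s \<in> I" "t \<in> I" "y s = y t"
    have *: "x i \<noteq> x j - 1" if "i \<in> {1..k}" "j \<in> {1..k}" for i j
      using inj[OF that] by (cases "i = j") (auto simp: algebra_simps)
    have **: "i = j" if "i \<in> {1..k}" "j \<in> {1..k}" "x i = x j" for i j
      using inj[OF that(1,2)] that(3) by blast
    show "s = t"
    proof (cases s; cases t)
      fix i j assume "s = Inl i" "t = Inl j"
      thus ?thesis using st ** by (auto simp: I_def y_def)
    next
      fix i j assume "s = Inr i" "t = Inr j"
      thus ?thesis using st ** by (auto simp: I_def y_def)
    next
      fix i j assume "s = Inl i" "t = Inr j"
      thus ?thesis using st *[of i j] by (auto simp: I_def y_def)
    next
      fix i j assume "s = Inr i" "t = Inl j"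
      thus ?thesis using st *[of j i] by (force simp: I_def y_def)
    qed
  qed
  have cards: "card I = card J"
    using assms(1) by (simp add: I_def J_def card_Plus)
  have remL: "I - {Inl i} = ({1..k} - {i}) <+> {1..k}" if "i \<in> {1..k}" for i
    by (auto simp: I_def)
  have remR: "I - {Inr i} = {1..k} <+> ({1..k} - {i})" if "i \<in> {1..k}" for i
    by (auto simp: I_def)
  have pl: "(\<Prod>j\<in>J. y s - c j) = (\<Prod>j=1..k+1. y s - a j) * (\<Prod>j=1..k-1. y s + 1 - b j)" for s
    unfolding J_def by (subst prod.Plus) (auto simp: c_def algebra_simps)
  have split_one: "(\<Prod>j\<in>{1..k}. f j) = f i * (\<Prod>j\<in>{1..k} - {i}. f j)" if "i \<in> {1..k}" for i and f :: "nat \<Rightarrow> complex"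
    using that by (subst prod.remove[of _ i]) auto
  have L: "(\<Prod>j\<in>I - {Inl i}. y (Inl i) - y j) = (\<Prod>j\<in>{1..k}-{i}. x i - x j) * (\<Prod>j\<in>{1..k}-{i}. x i + 1 - x j)"
    if i: "i \<in> {1..k}" for i
  proof -
    have "(\<Prod>j\<in>I - {Inl i}. y (Inl i) - y j) = (\<Prod>j\<in>{1..k}-{i}. x i - x j) * (\<Prod>j\<in>{1..k}. x i - (x j - 1))"
      unfolding remL[OF i] by (subst prod.Plus) (auto simp: y_def)
    thus ?thesis using i by (subst (asm) split_one[OF i]) (simp add: algebra_simps)
  qed
  have R: "(\<Prod>j\<in>I - {Inr i}. y (Inr i) - y j) = - ((\<Prod>j\<in>{1..k}-{i}. x i - x j) * (\<Prod>j\<in>{1..k}-{i}. x i - 1 - x j))"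
    if i: "i \<in> {1..k}" for i
  proof -
    have "(\<Prod>j\<in>I - {Inr i}. y (Inr i) - y j) = (\<Prod>j\<in>{1..k}. x i - 1 - x j) * (\<Prod>j\<in>{1..k}-{i}. x i - x j)"
      unfolding remR[OF i] by (subst prod.Plus) (auto simp: y_def)
    thus ?thesis using i by (subst (asm) split_one[OF i]) simp
  qed
  have "(\<Sum>i=1..k. gt_commutator k a b x i)
     = (\<Sum>i\<in>I. (\<Prod>j\<in>J. y i - c j) / (\<Prod>j\<in>I - {i}. y i - y j))"
  proof -
    have "(\<Sum>i\<in>I. (\<Prod>j\<in>J. y i - c j) / (\<Prod>j\<in>I - {i}. y i - y j))
      = (\<Sum>i=1..k. (\<Prod>j\<in>J. y (Inl i) - c j) / (\<Prod>j\<in>I - {Inl i}. y (Inl i) - y j)) +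
        (\<Sum>i=1..k. (\<Prod>j\<in>J. y (Inr i) - c j) / (\<Prod>j\<in>I - {Inr i}. y (Inr i) - y j))"
      by (subst (1) I_def, subst sum.Plus) auto
    also have "\<dots> = (\<Sum>i=1..k. gt_commutator k a b x i)"
      unfolding sum.distrib[symmetric]
    proof (intro sum.cong refl)
      fix i assume i: "i \<in> {1..k}"
      show "(\<Prod>j\<in>J. y (Inl i) - c j) / (\<Prod>j\<in>I - {Inl i}. y (Inl i) - y j) +
          (\<Prod>j\<in>J. y (Inr i) - c j) / (\<Prod>j\<in>I - {Inr i}. y (Inr i) - y j) = gt_commutator k a b x i"
        unfolding L[OF i] R[OF i] pl gt_commutator_def by (simp add: y_def)
    qed
    finally show ?thesis by simp
  qed
  also have "\<dots> = (\<Sum>i\<in>I. y i) - (\<Sum>j\<in>J. c j)"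
    by (rule sum_residues[OF fin injy cards])
  also have "(\<Sum>i\<in>I. y i) = 2 * (\<Sum>i=1..k. x i) - of_nat k"
    unfolding I_def by (subst sum.Plus) (auto simp: y_def sum_subtractf)
  also have "(\<Sum>j\<in>J. c j) = (\<Sum>i=1..k+1. a i) + (\<Sum>i=1..k-1. b i) - of_nat (k - 1)"
    unfolding J_def by (subst sum.Plus) (auto simp: c_def sum_subtractf)
  finally show ?thesis using assms(1) by (simp add: of_nat_diff)
qed

text \<open>Collisions \<open>x i + 1 = x j\<close> are removed by moving the \<open>i\<close>-th column by \<open>t * i\<close> and letting
  \<open>t\<close> tend to 0: the hypotheses make the colliding summands vanish identically in \<open>t\<close>.\<close>
lemma sum_gt_commutator:
  fixes x a b :: "nat \<Rightarrow> complex"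
  assumes k: "k \<ge> 1"
    and inj: "\<And>i j. i \<in> {1..k} \<Longrightarrow> j \<in> {1..k} \<Longrightarrow> i \<noteq> j \<Longrightarrow> x i \<noteq> x j"
    and up: "\<And>i j. i \<in> {1..k} \<Longrightarrow> j \<in> {1..k} \<Longrightarrow> i \<noteq> j \<Longrightarrow> x i + 1 = x j \<Longrightarrow> a i = x i"
    and down: "\<And>i j. i \<in> {1..k} \<Longrightarrow> j \<in> {1..k} \<Longrightarrow> i \<noteq> j \<Longrightarrow> x i - 1 = x j \<Longrightarrow> i < k \<and> b i = x i"
  shows "(\<Sum>i=1..k. gt_commutator k a b x i) = 2 * (\<Sum>i=1..k. x i) - (\<Sum>i=1..k-1. b i) - (\<Sum>i=1..k+1. a i) - 1"
proof -
  define X where "X t i = x i + of_real t * of_nat i" for t :: real and i :: nat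
  \<comment> \<open>The rows above and below move together with column \<open>i\<close>, so a
    coincidence \<open>a i = x i\<close> or \<open>b i = x i\<close> persists for all
    \<open>t\<close>.\<close>
  define A where "A t i = a i + of_real t * of_nat i" for t :: real and i :: nat
  define B where "B t i = b i + of_real t * of_nat i" for t :: real and i :: nat
  let ?R = "\<lambda>t. 2 * (\<Sum>i=1..k. X t i) - (\<Sum>i=1..k-1. B t i) - (\<Sum>i=1..k+1. A t i) - 1"
  have lX: "((\<lambda>t. X t i) \<longlongrightarrow> x i) (at 0)" for i
    unfolding X_def by (rule tendsto_eq_intros refl | simp)+
  have lA: "((\<lambda>t. A t i) \<longlongrightarrow> a i) (at 0)" for i
    unfolding A_def by (rule tendsto_eq_intros refl | simp)+
  have lB: "((\<lambda>t. B t i) \<longlongrightarrow> b i) (at 0)" for i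
    unfolding B_def by (rule tendsto_eq_intros refl | simp)+
  have lim1: "((\<lambda>t. \<Sum>i=1..k. gt_commutator k (A t) (B t) (X t) i) \<longlongrightarrow> (\<Sum>i=1..k. gt_commutator k a b x i)) (at 0)"
  proof (rule tendsto_sum)
    fix i assume i: "i \<in> {1..k}"
    have d0: "(\<Prod>j\<in>{1..k}-{i}. x i - x j) \<noteq> 0"
      using inj[OF i] by auto
    have c1: "((\<lambda>t. (\<Prod>j=1..k+1. X t i - A t j) * (\<Prod>j=1..k-1. X t i + 1 - B t j) /
       ((\<Prod>j\<in>{1..k}-{i}. X t i - X t j) * (\<Prod>j\<in>{1..k}-{i}. X t i + 1 - X t j))) \<longlongrightarrow>
       (\<Prod>j=1..k+1. x i - a j) * (\<Prod>j=1..k-1. x i + 1 - b j) /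
       ((\<Prod>j\<in>{1..k}-{i}. x i - x j) * (\<Prod>j\<in>{1..k}-{i}. x i + 1 - x j))) (at 0)"
    proof (cases "(\<Prod>j\<in>{1..k}-{i}. x i + 1 - x j) = 0")
      case False
      show ?thesis using False d0 by (intro tendsto_intros lX lA lB) auto
    next
      case True
      then obtain j where "j \<in> {1..k} - {i}" "x i + 1 - x j = 0" by (subst (asm) prod_zero_iff) blast+
      hence "a i = x i" using up[OF i, of j] by auto
      hence "X t i = A t i" for t by (simp add: X_def A_def)
      hence "(\<Prod>j=1..k+1. X t i - A t j) = 0" for t using i by auto
      \<comment> \<open>The approximating terms are 0 through their numerator; the limit term has
        denominator 0 and is 0 by the convention for division.\<close>
      thus ?thesis unfolding True by (simp only: mult_zero_left mult_zero_right div_0 div_by_0 tendsto_const)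
    qed
    have c2: "((\<lambda>t. (\<Prod>j=1..k+1. X t i - 1 - A t j) * (\<Prod>j=1..k-1. X t i - B t j) /
       ((\<Prod>j\<in>{1..k}-{i}. X t i - X t j) * (\<Prod>j\<in>{1..k}-{i}. X t i - 1 - X t j))) \<longlongrightarrow>
       (\<Prod>j=1..k+1. x i - 1 - a j) * (\<Prod>j=1..k-1. x i - b j) /
       ((\<Prod>j\<in>{1..k}-{i}. x i - x j) * (\<Prod>j\<in>{1..k}-{i}. x i - 1 - x j))) (at 0)"
    proof (cases "(\<Prod>j\<in>{1..k}-{i}. x i - 1 - x j) = 0")
      case False
      show ?thesis using False d0 by (intro tendsto_intros lX lA lB) auto
    next
      case True
      then obtain j where "j \<in> {1..k} - {i}" "x i - 1 - x j = 0" by (subst (asm) prod_zero_iff) blast+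
      hence ik: "i < k" and "b i = x i" using down[OF i, of j] by auto
      hence "X t i = B t i" for t by (simp add: X_def B_def)
      hence "(\<Prod>j=1..k-1. X t i - B t j) = 0" for t using i ik by (auto intro!: bexI[of _ i])
      thus ?thesis unfolding True by (simp only: mult_zero_left mult_zero_right div_0 div_by_0 tendsto_const)
    qed
    show "((\<lambda>t. gt_commutator k (A t) (B t) (X t) i) \<longlongrightarrow> gt_commutator k a b x i) (at 0)"
      unfolding gt_commutator_def by (rule tendsto_diff[OF c1 c2])
  qed
  have lim2: "(?R \<longlongrightarrow> 2 * (\<Sum>i=1..k. x i) - (\<Sum>i=1..k-1. b i) - (\<Sum>i=1..k+1. a i) - 1) (at 0)"
    by (intro tendsto_intros lX lA lB)
  have ev: "\<forall>\<^sub>F t in at 0. (\<Sum>i=1..k. gt_commutator k (A t) (B t) (X t) i) = ?R t"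
  proof -
    \<comment> \<open>A collision is an affine equation in \<open>t\<close> with slope
      \<open>i - j\<close>, so it fails for all small nonzero \<open>t\<close>.\<close>
    have ev: "\<forall>\<^sub>F t in at 0. c + of_real t * d \<noteq> (0::complex)" if "c \<noteq> 0 \<or> d \<noteq> 0" for c d :: complex
    proof (cases "c = 0")
      case True
      thus ?thesis using that by (simp add: eventually_at_filter)
    next
      case False
      have "((\<lambda>t::real. c + of_real t * d) \<longlongrightarrow> c) (at 0)"
        by (rule tendsto_eq_intros refl | simp)+
      thus ?thesis using False by (rule tendsto_imp_eventually_ne)
    qed
    have "\<forall>\<^sub>F t in at 0. \<forall>i\<in>{1..k}. \<forall>j\<in>{1..k}. i \<noteq> j \<longrightarrow> X t i \<noteq> X t j \<and> X t i + 1 \<noteq> X t j"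
    proof (intro eventually_ball_finite ballI finite_atLeastAtMost)
      fix i j assume ij: "i \<in> {1..k}" "j \<in> {1..k}"
      show "\<forall>\<^sub>F t in at 0. i \<noteq> j \<longrightarrow> X t i \<noteq> X t j \<and> X t i + 1 \<noteq> X t j"
      proof (cases "i = j")
        case False
        hence d: "of_nat i - of_nat j \<noteq> (0::complex)" by simp
        have "\<forall>\<^sub>F t in at 0. (x i - x j) + of_real t * (of_nat i - of_nat j) \<noteq> 0"
          "\<forall>\<^sub>F t in at 0. (x i + 1 - x j) + of_real t * (of_nat i - of_nat j) \<noteq> 0"
          by (rule ev, use d in simp)+
        thus ?thesis by eventually_elim (auto simp: X_def algebra_simps)
      qed simp
    qed
    thus ?thesis
      by (rule eventually_mono) (rule sum_gt_commutator_generic[OF k], blast)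
  qed
  show ?thesis
    using LIM_unique[OF tendsto_cong[OF ev, THEN iffD1, OF lim1] lim2] .
qed

section \<open>The Lie algebra and its automorphisms\<close>

lemma Eu_in_sl: "i \<in> idx n \<Longrightarrow> j \<in> idx n \<Longrightarrow> i \<noteq> j \<Longrightarrow> Eu i j \<in> sl n"
  by (auto simp: sl_def Eu_def intro!: sum.neutral)

lemma ee_in_sl: "k \<in> {1..n} \<Longrightarrow> ee k \<in> sl n"
  unfolding ee_def by (rule Eu_in_sl) (auto simp: idx_def)

lemma ff_in_sl: "k \<in> {1..n} \<Longrightarrow> ff k \<in> sl n"
  unfolding ff_def by (rule Eu_in_sl) (auto simp: idx_def)

lemma hh_in_cartan: "k \<in> {1..n} \<Longrightarrow> hh k \<in> cartan n"
  by (auto simp: cartan_def sl_def hh_def madd_def msmult_def Eu_def idx_def sum_subtractf)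

lemma cartan_subset_sl: "cartan n \<subseteq> sl n"
  by (auto simp: cartan_def)

lemma hh_in_sl: "k \<in> {1..n} \<Longrightarrow> hh k \<in> sl n"
  using hh_in_cartan cartan_subset_sl by blast

lemma madd_in_sl: "X \<in> sl n \<Longrightarrow> Y \<in> sl n \<Longrightarrow> madd X Y \<in> sl n"
  by (auto simp: sl_def madd_def sum.distrib)

lemma msmult_in_sl: "X \<in> sl n \<Longrightarrow> msmult c X \<in> sl n"
  by (auto simp: sl_def msmult_def sum_distrib_left[symmetric])

lemma bracket_in_sl:
  assumes "X \<in> sl n" "Y \<in> sl n"
  shows "bracket n X Y \<in> sl n"
proof -
  have "(\<Sum>a\<in>idx n. mmul n X Y a a) = (\<Sum>a\<in>idx n. mmul n Y X a a)"
    unfolding mmul_def by (subst sum.swap) (simp add: mult.commute)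
  thus ?thesis
    using assms by (auto simp: sl_def bracket_def mmul_def sum_subtractf)
qed

lemma bracket_msmult_Eu:
  assumes "p \<in> idx n" "r \<in> idx n"
  shows "bracket n (msmult t (Eu p r)) X a b
       = (if a = p then t * X r b else 0) - (if b = r then t * X a p else 0)"
proof -
  have fin: "finite (idx n)" by (simp add: idx_def)
  have "mmul n (msmult t (Eu p r)) X a b = (\<Sum>c\<in>idx n. if c = r then (if a = p then t * X r b else 0) else 0)"
    unfolding mmul_def by (rule sum.cong) (auto simp: msmult_def Eu_def)
  moreover have "mmul n X (msmult t (Eu p r)) a b = (\<Sum>c\<in>idx n. if c = p then (if b = r then t * X a p else 0) else 0)"
    unfolding mmul_def by (rule sum.cong) (auto simp: msmult_def Eu_def)
  ultimately show ?thesis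
    using assms fin by (simp add: bracket_def)
qed

lemma msmult_one: "msmult 1 X = X" by (simp add: msmult_def)

lemma bracket_Eu:
  assumes "p \<in> idx n" "r \<in> idx n"
  shows "bracket n (Eu p r) X a b = (if a = p then X r b else 0) - (if b = r then X a p else 0)"
  using bracket_msmult_Eu[OF assms, of 1 X a b] by (simp add: msmult_one)

lemma bracket_ee_ff:
  assumes "k \<in> {1..n}" "l \<in> {1..n}"
  shows "bracket n (ee k) (ff l) = (if k = l then hh k else msmult 0 (ee k))"
proof (intro ext)
  fix a b
  have "k \<in> idx n" "k + 1 \<in> idx n" using assms by (auto simp: idx_def)
  thus "bracket n (ee k) (ff l) a b = (if k = l then hh k else msmult 0 (ee k)) a b"
    unfolding ee_def ff_def by (subst bracket_Eu) (auto simp: hh_def madd_def msmult_def Eu_def)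
qed

lemma bracket_cartan_ff:
  assumes "H \<in> cartan n" "l \<in> {1..n}"
  shows "bracket n H (ff l) = msmult (- alpha l H) (ff l)"
proof (intro ext)
  fix a b
  have i: "l + 1 \<in> idx n" "l \<in> idx n" using assms by (auto simp: idx_def)
  have d: "\<And>a b. a \<noteq> b \<Longrightarrow> H a b = 0" using assms by (auto simp: cartan_def)
  have "bracket n H (ff l) a b = - bracket n (ff l) H a b"
    by (simp add: bracket_def)
  also have "\<dots> = msmult (- alpha l H) (ff l) a b"
    using d unfolding ff_def bracket_Eu[OF i] by (auto simp: msmult_def Eu_def alpha_def)
  finally show "bracket n H (ff l) a b = msmult (- alpha l H) (ff l) a b" .
qed

lemma wt_fun_hh:
  assumes "k \<in> {1..n}"
  shows "wt_fun n c (hh k) = c k"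
proof -
  have "(\<Sum>j=1..i. hh k j j) = (if i = k then 1 else 0)" if "i \<in> {1..n}" for i
  proof -
    have "(\<Sum>j=1..i. hh k j j) = (\<Sum>j=1..i. (if j = k then 1 else 0)) - (\<Sum>j=1..i. (if j = k + 1 then 1 else 0))"
      unfolding sum_subtractf[symmetric] by (rule sum.cong) (auto simp: hh_def madd_def msmult_def Eu_def)
    thus ?thesis using assms that by auto
  qed
  hence "wt_fun n c (hh k) = (\<Sum>i=1..n. c i * (if i = k then 1 else 0))"
    unfolding wt_fun_def by (intro sum.cong) auto
  thus ?thesis using assms by (simp add: if_distrib[of "(*) _"] cong: if_cong)
qed

text \<open>The functional \<open>alpha l\<close> takes the value 1 on this element for every \<open>l\<close>, so it grades a
  highest weight module by depth.\<close>
definition grading_elt :: "nat \<Rightarrow> mat" where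
  "grading_elt n = (\<lambda>a b. if a = b \<and> a \<in> idx n then of_nat n / 2 + 1 - of_nat a else 0)"

lemma grading_elt_in_cartan: "grading_elt n \<in> cartan n"
proof -
  have "(\<Sum>a=1..m+1. of_nat m / 2 + 1 - of_nat a :: complex) = 0" for m
  proof -
    have "(\<Sum>a=1..r. of_nat a :: complex) = of_nat r * (of_nat r + 1) / 2" for r
      by (induction r) (auto simp: field_simps)
    from this[of "m + 1"] show ?thesis
      unfolding sum_subtractf by (simp add: field_simps)
  qed
  thus ?thesis by (auto simp: grading_elt_def cartan_def sl_def idx_def)
qed

lemma alpha_grading_elt: "l \<in> {1..n} \<Longrightarrow> alpha l (grading_elt n) = 1"
  by (auto simp: grading_elt_def alpha_def idx_def)

text \<open>This reduces stability under all of \<open>sl n\<close> to stability under the Chevalley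
  generators. Brackets of neighbouring units produce every off-diagonal unit, and
  \<open>[ee k, ff k]\<close> produces the diagonal.\<close>

lemma sl_generated:
  assumes sub: "G \<subseteq> sl n"
    and add: "\<And>X Y. X \<in> G \<Longrightarrow> Y \<in> G \<Longrightarrow> madd X Y \<in> G"
    and smult: "\<And>c X. X \<in> G \<Longrightarrow> msmult c X \<in> G"
    and brk: "\<And>X Y. X \<in> G \<Longrightarrow> Y \<in> G \<Longrightarrow> bracket n X Y \<in> G"
    and gen: "\<And>k. k \<in> {1..n} \<Longrightarrow> ee k \<in> G \<and> ff k \<in> G"
    and n: "n \<ge> 1"
  shows "G = sl n"
proof
  show "sl n \<subseteq> G"
  proof
    fix X assume X: "X \<in> sl n"
    have zero: "(\<lambda>a b. 0) \<in> G"
      using smult[of "ee 1" 0] gen[of 1] n by (auto simp: msmult_def)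
    have sums: "(\<lambda>a b. \<Sum>k\<in>K. c k * Y k a b) \<in> G" if "finite K" "\<And>k. k \<in> K \<Longrightarrow> Y k \<in> G"
      for K :: "'k set" and c Y
      using that
    proof (induction K rule: finite_induct)
      case (insert k K)
      have "madd (msmult (c k) (Y k)) (\<lambda>a b. \<Sum>k\<in>K. c k * Y k a b) \<in> G"
        using insert by (intro add smult) auto
      thus ?case using insert.hyps by (simp add: madd_def msmult_def)
    qed (simp add: zero)
    have upper: "Eu i (i + Suc d) \<in> G" if "i \<ge> 1" "i + Suc d \<le> n + 1" for i d
      using that
    proof (induction d)
      case 0
      thus ?case using gen[of i] by (simp add: ee_def)
    next
      case (Suc d)
      have "bracket n (Eu i (i + Suc d)) (ee (i + Suc d)) \<in> G"
        using Suc gen by (intro brk) auto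
      moreover have "bracket n (Eu i (i + Suc d)) (ee (i + Suc d)) = Eu i (i + Suc (Suc d))"
        using Suc.prems by (intro ext, subst bracket_Eu) (auto simp: idx_def ee_def Eu_def)
      ultimately show ?case by simp
    qed
    have lower: "Eu (i + Suc d) i \<in> G" if "i \<ge> 1" "i + Suc d \<le> n + 1" for i d
      using that
    proof (induction d)
      case 0
      thus ?case using gen[of i] by (simp add: ff_def)
    next
      case (Suc d)
      have "bracket n (ff (i + Suc d)) (Eu (i + Suc d) i) \<in> G"
        using Suc gen by (intro brk) auto
      moreover have "bracket n (ff (i + Suc d)) (Eu (i + Suc d) i) = Eu (i + Suc (Suc d)) i"
        using Suc.prems unfolding ff_def by (intro ext, subst bracket_Eu) (auto simp: idx_def Eu_def)
      ultimately show ?case by simp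
    qed
    have off: "Eu i j \<in> G" if "i \<in> idx n" "j \<in> idx n" "i \<noteq> j" for i j
    proof (cases "i < j")
      case True
      thus ?thesis using upper[of i "j - i - 1"] that by (auto simp: idx_def)
    next
      case False
      thus ?thesis using lower[of j "i - j - 1"] that by (auto simp: idx_def)
    qed
    have hG: "hh k \<in> G" if "k \<in> {1..n}" for k
      using brk[of "ee k" "ff k"] gen[OF that] bracket_ee_ff[OF that that] by simp
    define Off where "Off = {p \<in> idx n \<times> idx n. fst p \<noteq> snd p}"
    \<comment> \<open>Abel summation on the diagonal: the coefficient of \<open>hh k\<close> is the
      partial trace up to \<open>k\<close>, and the vanishing of the full trace accounts for the
      last entry.\<close>
    define s where "s k = (\<Sum>j=1..k. X j j)" for k
    define Y where "Y = (\<lambda>a b. \<Sum>p\<in>Off. X (fst p) (snd p) * Eu (fst p) (snd p) a b)"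
    define Z where "Z = (\<lambda>a b. \<Sum>k\<in>{1..n}. s k * hh k a b)"
    have finOff: "finite Off" by (auto simp: Off_def idx_def)
    have "Y \<in> G" unfolding Y_def
      by (rule sums[OF finOff]) (auto simp: Off_def intro: off)
    moreover have "Z \<in> G" unfolding Z_def
      by (rule sums) (auto intro: hG)
    moreover have "X = madd Y Z"
    proof (intro ext)
      fix a b
      have Y: "Y a b = (if (a, b) \<in> Off then X a b else 0)"
      proof -
        have "Y a b = (\<Sum>p\<in>Off. if p = (a, b) then X a b else 0)"
          unfolding Y_def by (rule sum.cong) (auto simp: Eu_def)
        thus ?thesis using finOff by simp
      qed
      have Z: "Z a b = (if a = b then (if a \<in> {1..n} then s a else 0) - (if a - 1 \<in> {1..n} then s (a - 1) else 0) else 0)"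
      proof (cases "a = b")
        case True
        have "Z a b = (\<Sum>k\<in>{1..n}. (if k = a then s a else 0) - (if k = a - 1 then s (a - 1) else 0))"
          unfolding Z_def using True by (intro sum.cong refl) (auto simp: hh_def madd_def msmult_def Eu_def)
        thus ?thesis using True by (simp add: sum_subtractf)
      next
        case False
        have "Z a b = 0"
          unfolding Z_def using False by (intro sum.neutral) (auto simp: hh_def madd_def msmult_def Eu_def)
        thus ?thesis using False by simp
      qed
      have s_step: "s a - s (a - 1) = X a a" if "a \<ge> 1"
        using that unfolding s_def by (cases a) auto
      have sn: "s (Suc n) = 0" using X by (auto simp: sl_def idx_def s_def)
      have s0: "s 0 = 0" by (simp add: s_def)
      have diag: "X a a = (if a \<in> {1..n} then s a else 0) - (if a - 1 \<in> {1..n} then s (a - 1) else 0)"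
      proof (cases "a \<in> idx n")
        case True
        consider "a = n + 1" | "a = 1" "a \<le> n" | "a > 1" "a \<le> n"
          using True by (fastforce simp: idx_def)
        thus ?thesis using s_step sn s0 n by cases auto
      next
        case False
        thus ?thesis using X by (auto simp: idx_def sl_def)
      qed
      show "X a b = madd Y Z a b"
        using X diag by (auto simp: madd_def Y Z Off_def sl_def)
    qed
    ultimately show "X \<in> G" using add by blast
  qed
qed (rule sub)

section \<open>Automorphisms in \<open>Wbar\<close> and twisted modules\<close>

text \<open>Bijectivity is asked on \<open>sl n\<close> only, since matrices here are functions on
  all pairs of naturals and \<open>sigma_inv\<close> erases entries outside the index range.
  Bijectivity on \<open>cartan n\<close> makes \<open>hstar_act\<close> a genuine pull-back along
  the inverse.\<close>

definition lie_aut :: "nat \<Rightarrow> (mat \<Rightarrow> mat) \<Rightarrow> bool" where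
  "lie_aut n u \<longleftrightarrow> bij_betw u (sl n) (sl n) \<and> bij_betw u (cartan n) (cartan n) \<and>
     (\<forall>X\<in>sl n. \<forall>Y\<in>sl n. u (madd X Y) = madd (u X) (u Y)) \<and>
     (\<forall>X\<in>sl n. \<forall>c. u (msmult c X) = msmult c (u X)) \<and>
     (\<forall>X\<in>sl n. \<forall>Y\<in>sl n. u (bracket n X Y) = bracket n (u X) (u Y))"

lemma lie_aut_id: "lie_aut n id"
  by (simp add: lie_aut_def)

lemma lie_aut_comp:
  assumes "lie_aut n u" "lie_aut n v"
  shows "lie_aut n (u \<circ> v)"
proof -
  have "v X \<in> sl n" if "X \<in> sl n" for X
    using assms(2) that by (auto simp: lie_aut_def bij_betw_def)
  thus ?thesis using assms unfolding lie_aut_def by (auto intro: bij_betw_trans)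
qed

text \<open>Such a map is conjugation by a signed permutation matrix; \<open>w\<close> below is
  conjugation by the inverse matrix.\<close>

lemma lie_aut_signed_perm:
  assumes perm: "t permutes idx n" and sgn: "\<And>a. g a * g a = (1::complex)"
    and u: "\<And>X a b. X \<in> sl n \<Longrightarrow> u X a b = g a * g b * X (t a) (t b)"
  shows "lie_aut n u"
proof -
  have tin: "t a \<in> idx n \<longleftrightarrow> a \<in> idx n" for a using perm by (simp add: permutes_in_image)
  have sgn3: "g a * (g a * z) = z" for a z using sgn[of a] by (simp add: mult.assoc[symmetric])
  have u': "u X = (\<lambda>a b. g a * g b * X (t a) (t b))" if "X \<in> sl n" for X
    using u[OF that] by (intro ext)
  have inv1: "t (inv t a) = a" "inv t (t a) = a" for a using perm by (simp_all add: permutes_inverses)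
  have insl: "u X \<in> sl n" if "X \<in> sl n" for X
  proof -
    have "(\<Sum>a\<in>idx n. X (t a) (t a)) = (\<Sum>a\<in>idx n. X a a)"
      using sum.permute[OF perm, of "\<lambda>a. X a a"] by simp
    thus ?thesis using that sgn unfolding u'[OF that] by (auto simp: sl_def tin)
  qed
  define w where "w X = (\<lambda>a b. g (inv t a) * g (inv t b) * X (inv t a) (inv t b))" for X :: mat
  have permi: "inv t permutes idx n" using perm by (rule permutes_inv)
  have itin: "inv t a \<in> idx n \<longleftrightarrow> a \<in> idx n" for a using permi by (simp add: permutes_in_image)
  have winsl: "w X \<in> sl n" if "X \<in> sl n" for X
  proof -
    have "(\<Sum>a\<in>idx n. X (inv t a) (inv t a)) = (\<Sum>a\<in>idx n. X a a)"
      using sum.permute[OF permi, of "\<lambda>a. X a a"] by simp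
    thus ?thesis using that sgn unfolding w_def by (auto simp: sl_def itin)
  qed
  have wu: "w (u X) = X" if "X \<in> sl n" for X
    unfolding u'[OF that] w_def by (intro ext) (simp add: inv1 mult.assoc mult.left_commute sgn3)
  have uw: "u (w X) = X" if "X \<in> sl n" for X
    unfolding u'[OF winsl[OF that]] unfolding w_def by (intro ext) (simp add: inv1 mult.assoc mult.left_commute sgn3)
  have car: "u X \<in> cartan n" if "X \<in> cartan n" for X
  proof -
    have X: "X \<in> sl n" using that cartan_subset_sl by blast
    have "t a \<noteq> t b" if "a \<noteq> b" for a b using that inv1 by metis
    thus ?thesis using that insl[OF X] unfolding cartan_def by (auto simp: u[OF X])
  qed
  have wcar: "w X \<in> cartan n" if "X \<in> cartan n" for X
  proof -
    have X: "X \<in> sl n" using that cartan_subset_sl by blast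
    have "inv t a \<noteq> inv t b" if "a \<noteq> b" for a b using that inv1 by metis
    thus ?thesis using that winsl[OF X] unfolding cartan_def by (auto simp: w_def)
  qed
  have b1: "bij_betw u (sl n) (sl n)"
    by (rule bij_betw_byWitness[where f' = w]) (auto simp: wu uw insl winsl)
  have b2: "bij_betw u (cartan n) (cartan n)"
    using cartan_subset_sl[of n]
    by (intro bij_betw_byWitness[where f' = w]) (auto simp: wu uw car wcar subset_iff)
  have mm: "g a * g b * mmul n X Y (t a) (t b) = mmul n (u X) (u Y) a b" if "X \<in> sl n" "Y \<in> sl n" for X Y a b
  proof -
    have "mmul n X Y (t a) (t b) = (\<Sum>c\<in>idx n. X (t a) (t c) * Y (t c) (t b))"
      unfolding mmul_def using sum.permute[OF perm, of "\<lambda>c. X (t a) c * Y c (t b)"] by simp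
    thus ?thesis unfolding mmul_def u'[OF that(1)] u'[OF that(2)]
      by (auto simp: sum_distrib_left mult_ac sgn3 intro!: sum.cong)
  qed
  have b3: "u (bracket n X Y) = bracket n (u X) (u Y)" if "X \<in> sl n" "Y \<in> sl n" for X Y
    unfolding u'[OF bracket_in_sl[OF that]]
    unfolding bracket_def by (intro ext) (simp add: mm that flip: mm right_diff_distrib)
  show ?thesis unfolding lie_aut_def
    using b1 b2 b3
    by (auto simp: u' madd_in_sl msmult_in_sl) (auto simp: madd_def msmult_def algebra_simps)
qed

text \<open>Since \<open>p \<noteq> r\<close>, the unit squares to 0, so the cube of its
  \<open>ad\<close> vanishes and three terms of the series remain. The result is conjugation by
  \<open>1 + t * Eu p r\<close>.\<close>

lemma expad_msmult_Eu:
  assumes "p \<in> idx n" "r \<in> idx n" "p \<noteq> r"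
  shows "expad n (msmult t (Eu p r)) X = (\<lambda>a b. X a b + (if a = p then t * X r b else 0)
     - (if b = r then t * X a p else 0) - (if a = p \<and> b = r then t * t * X r p else 0))"
proof (intro ext)
  fix a b
  let ?A = "ad n (msmult t (Eu p r))"
  have ad: "?A Y = (\<lambda>a b. (if a = p then t * Y r b else 0) - (if b = r then t * Y a p else 0))" for Y
    unfolding ad_def by (intro ext) (rule bracket_msmult_Eu[OF assms(1,2)])
  have p2: "(?A ^^ 2) X = (\<lambda>a b. if a = p \<and> b = r then - 2 * t * t * X r p else 0)"
    using assms(3) by (auto simp: numeral_2_eq_2 ad fun_eq_iff)
  have zero: "?A (\<lambda>a b. 0) = (\<lambda>a b. 0)" by (simp add: ad cong: if_cong)
  have p3: "(?A ^^ (k + 3)) X = (\<lambda>a b. 0)" for k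
  proof (induction k)
    case 0
    have "(?A ^^ 3) X = ?A ((?A ^^ 2) X)" by (simp add: numeral_3_eq_3 numeral_2_eq_2)
    also have "\<dots> = (\<lambda>a b. 0)" unfolding p2 unfolding ad using assms(3) by (auto simp: fun_eq_iff)
    finally show ?case by simp
  next
    case (Suc k)
    thus ?case by (simp only: add_Suc funpow.simps comp_apply zero)
  qed
  have "(\<Sum>k\<le>2*n+2. ((?A ^^ k) X) a b / of_nat (fact k)) = (\<Sum>k\<le>2. ((?A ^^ k) X) a b / of_nat (fact k))"
  proof (rule sum.mono_neutral_right)
    show "\<forall>k\<in>{..2*n+2} - {..2}. ((?A ^^ k) X) a b / of_nat (fact k) = 0"
    proof
      fix k assume "k \<in> {..2*n+2} - {..2}"
      hence "k = (k - 3) + 3" by auto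
      thus "((?A ^^ k) X) a b / of_nat (fact k) = 0" using p3[of "k - 3"] by simp
    qed
  qed auto
  also have "\<dots> = X a b + ?A X a b + (?A ^^ 2) X a b / 2"
    by (simp add: numeral_2_eq_2)
  finally show "expad n (msmult t (Eu p r)) X a b = X a b + (if a = p then t * X r b else 0)
     - (if b = r then t * X a p else 0) - (if a = p \<and> b = r then t * t * X r p else 0)"
    unfolding expad_def unfolding p2 unfolding ad by auto
qed

text \<open>In rows \<open>i\<close>, \<open>i+1\<close> the three exponentials multiply to the 2 by
  2 matrix with rows \<open>(0, -1)\<close> and \<open>(1, 0)\<close>; hence the transposition and
  the single sign at \<open>i\<close>.\<close>

lemma refl_r_signed_perm:
  assumes "i \<in> {1..n}"
  shows "refl_r n i X a b = (if a = i then -1 else 1) * (if b = i then -1 else 1)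
     * X (transpose i (i+1) a) (transpose i (i+1) b)"
proof -
  have i: "i \<in> idx n" "i + 1 \<in> idx n" "i \<noteq> i + 1" "i + 1 \<noteq> i" using assms by (auto simp: idx_def)
  have f: "ff i = msmult 1 (Eu (i+1) i)" by (simp add: ff_def msmult_one)
  show ?thesis
    unfolding refl_r_def comp_def f ee_def expad_msmult_Eu[OF i(2,1,4)] expad_msmult_Eu[OF i(1,2,3)]
    by (auto simp: transpose_def)
qed

lemma lie_aut_refl_r:
  assumes "i \<in> {1..n}"
  shows "lie_aut n (refl_r n i)"
proof (rule lie_aut_signed_perm[where g = "\<lambda>a. if a = i then -1 else 1"])
  show "transpose i (i+1) permutes idx n"
    using assms by (intro permutes_swap_id) (auto simp: idx_def)
qed (simp_all add: refl_r_signed_perm[OF assms] del: One_nat_def)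

lemma sigma_inv_involution: "X \<in> sl n \<Longrightarrow> sigma_inv n (sigma_inv n X) = X"
proof (intro ext)
  fix a b assume X: "X \<in> sl n"
  show "sigma_inv n (sigma_inv n X) a b = X a b"
  proof (cases "a \<in> idx n \<and> b \<in> idx n")
    case True
    hence i: "n + 2 - a \<in> idx n" "n + 2 - b \<in> idx n" "n + 2 - (n + 2 - a) = a" "n + 2 - (n + 2 - b) = b"
      by (auto simp: idx_def)
    have "(-1::complex) ^ (a + b) * (-1) ^ (n + 2 - b + (n + 2 - a)) = (-1) ^ (2 * (n + 2))"
      using True by (subst power_add[symmetric]) (auto simp: idx_def intro!: arg_cong[where f = "\<lambda>z. (-1) ^ z"])
    also have "\<dots> = 1" by (simp only: power_mult power2_eq_square) simp
    finally show ?thesis using True i by (simp add: sigma_inv_def mult.assoc[symmetric])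
  next
    case False
    thus ?thesis using X by (auto simp: sigma_inv_def sl_def)
  qed
qed

text \<open>Up to signs this is minus the transpose along the antidiagonal, not a conjugation. It
  reverses products, and the minus sign turns the reversed commutator back.\<close>

lemma lie_aut_sigma_inv: "lie_aut n (sigma_inv n)"
proof -
  have bij: "bij_betw (\<lambda>a. n + 2 - a) (idx n) (idx n)"
    by (rule bij_betw_byWitness[where f' = "\<lambda>a. n + 2 - a"]) (auto simp: idx_def)
  have reidx: "(\<Sum>c\<in>idx n. f (n + 2 - c)) = (\<Sum>c\<in>idx n. f c)" for f :: "nat \<Rightarrow> complex"
    using sum.reindex_bij_betw[OF bij, of f] by simp
  have insl: "sigma_inv n X \<in> sl n" if "X \<in> sl n" for X
  proof -
    have "(\<Sum>a\<in>idx n. sigma_inv n X a a) = (\<Sum>a\<in>idx n. - X (n + 2 - a) (n + 2 - a))"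
      by (intro sum.cong refl) (simp add: sigma_inv_def)
    also have "\<dots> = 0" using reidx[of "\<lambda>a. X a a"] that by (simp add: sum_negf sl_def)
    finally show ?thesis by (auto simp: sl_def sigma_inv_def)
  qed
  have car: "sigma_inv n X \<in> cartan n" if "X \<in> cartan n" for X
    using that insl[of X] unfolding cartan_def by (auto simp: sigma_inv_def idx_def)
  have b1: "bij_betw (sigma_inv n) (sl n) (sl n)"
    by (rule bij_betw_byWitness[where f' = "sigma_inv n"]) (auto simp: sigma_inv_involution insl)
  have b2: "bij_betw (sigma_inv n) (cartan n) (cartan n)"
    using cartan_subset_sl[of n]
    by (intro bij_betw_byWitness[where f' = "sigma_inv n"]) (auto simp: sigma_inv_involution car subset_iff)
  have mm: "mmul n (sigma_inv n X) (sigma_inv n Y) a b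
      = (if a \<in> idx n \<and> b \<in> idx n then (-1) ^ (a + b) * mmul n Y X (n + 2 - b) (n + 2 - a) else 0)" for X Y a b
  proof (cases "a \<in> idx n \<and> b \<in> idx n")
    case True
    have "mmul n (sigma_inv n X) (sigma_inv n Y) a b
      = (\<Sum>c\<in>idx n. (-1) ^ (a + b) * (Y (n + 2 - b) (n + 2 - c) * X (n + 2 - c) (n + 2 - a)))"
      unfolding mmul_def
    proof (intro sum.cong refl)
      fix c assume c: "c \<in> idx n"
      have "(-1::complex) ^ (a + c) * (-1) ^ (c + b) = (-1) ^ (a + b) * ((-1) ^ c * (-1) ^ c)"
        by (simp add: power_add mult_ac)
      also have "(-1::complex) ^ c * (-1) ^ c = 1" by (simp flip: power_mult_distrib)
      finally show "sigma_inv n X a c * sigma_inv n Y c b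
          = (-1) ^ (a + b) * (Y (n + 2 - b) (n + 2 - c) * X (n + 2 - c) (n + 2 - a))"
        using True c by (simp add: sigma_inv_def algebra_simps)
    qed
    also have "\<dots> = (-1) ^ (a + b) * mmul n Y X (n + 2 - b) (n + 2 - a)"
      unfolding sum_distrib_left[symmetric] mmul_def
      using reidx[of "\<lambda>c. Y (n + 2 - b) c * X c (n + 2 - a)"] by simp
    finally show ?thesis using True by simp
  next
    case False
    thus ?thesis by (auto simp: mmul_def sigma_inv_def)
  qed
  have b3: "sigma_inv n (bracket n X Y) = bracket n (sigma_inv n X) (sigma_inv n Y)" for X Y
    unfolding bracket_def mm by (intro ext) (auto simp: sigma_inv_def algebra_simps)
  show ?thesis unfolding lie_aut_def
    using b1 b2 b3 by (auto simp: sigma_inv_def madd_def msmult_def algebra_simps intro!: ext)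
qed

lemma lie_aut_Wbar: "u \<in> Wbar n \<Longrightarrow> lie_aut n u"
  by (induction rule: Wbar.induct)
    (rule lie_aut_id lie_aut_comp[OF lie_aut_refl_r] lie_aut_comp[OF lie_aut_sigma_inv]; assumption)+

text \<open>As \<open>u\<close> maps \<open>sl n\<close> onto itself, both actions have the same
  stable subspaces, and the same vector serves as highest weight vector.\<close>

lemma simple_hw_module_twist:
  assumes u: "lie_aut n u" and hw: "simple_hw_module n scale \<rho> (u ` N) (hstar_act n u \<mu>)"
  shows "simple_hw_module n scale (\<lambda>X. \<rho> (u X)) N \<mu>"
proof -
  have im: "u ` sl n = sl n" and imc: "u ` cartan n = cartan n" and injc: "inj_on u (cartan n)"
    using u by (auto simp: lie_aut_def bij_betw_def)
  have insl: "u X \<in> sl n" if "X \<in> sl n" for X using im that by blast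
  have lm: "lie_module n scale \<rho>" using hw by (simp add: simple_hw_module_def simple_module_def)
  have "lie_module n scale (\<lambda>X. \<rho> (u X))"
    using lm u insl unfolding lie_module_def lie_aut_def by auto
  moreover have "(\<forall>X\<in>sl n. \<forall>w\<in>W. \<rho> (u X) w \<in> W) \<longleftrightarrow> (\<forall>X\<in>sl n. \<forall>w\<in>W. \<rho> X w \<in> W)" for W
    by (subst (2) im[symmetric]) simp
  ultimately have "simple_module n scale (\<lambda>X. \<rho> (u X))"
    using hw by (simp add: simple_hw_module_def simple_module_def)
  moreover have "hstar_act n u \<mu> (u H) = \<mu> H" if "H \<in> cartan n" for H
    using that injc by (simp add: hstar_act_def the_inv_into_f_f)
  ultimately show ?thesis
    using hw imc unfolding simple_hw_module_def by (metis image_eqI)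
qed

section \<open>The Gelfand--Tsetlin model\<close>

text \<open>Splitting a complex number into a representative modulo \<open>\<int>\<close> and an integer turns the
  relations between array entries into linear integer arithmetic.\<close>
definition ip :: "complex \<Rightarrow> int" where "ip x = \<lfloor>Re x\<rfloor>"
definition rp :: "complex \<Rightarrow> complex" where "rp x = x - of_int (ip x)"

lemma ip_add_of_int [simp]: "ip (x + of_int t) = ip x + t" "ip (x + 1) = ip x + 1" "ip (x - 1) = ip x - 1"
  "ip (x + - 1) = ip x - 1"
  by (simp_all add: ip_def)

lemma rp_add_of_int [simp]: "rp (x + of_int t) = rp x" "rp (x + 1) = rp x" "rp (x - 1) = rp x"
  "rp (x + - 1) = rp x"
  by (simp_all add: rp_def)

lemma rp_ip_eqI: "rp x = rp y \<Longrightarrow> ip x = ip y \<Longrightarrow> x = y"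
  by (auto simp: rp_def)

lemma rp_eq_imp_diff: "rp x = rp y \<Longrightarrow> x - y = of_int (ip x - ip y)"
  by (simp add: rp_def algebra_simps)

lemma shift_apply: "shift v k i t r j = (if r = k \<and> j = i then v k i + t else v r j)"
  by (simp add: shift_def)

lemma shift_shift_cancel [simp]: "shift (shift v k i 1) k i (-1) = v" "shift (shift v k i (-1)) k i 1 = v"
  by (auto simp: shift_apply fun_eq_iff)

lemma shift_commute: "shift (shift v k i s) l j t = shift (shift v l j t) k i s"
  by (auto simp: shift_apply fun_eq_iff)

lemma shift_eq_iff: "shift w k i 1 = v \<longleftrightarrow> w = shift v k i (-1)" "shift w k i (-1) = v \<longleftrightarrow> w = shift v k i 1"
  by auto

lemma coefE_eq: "coefE v k i = (\<Prod>j=1..k+1. v k i - v (k+1) j) / (\<Prod>j\<in>{1..k}-{i}. v k i - v k j)"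
  by (simp add: coefE_def Let_def)

lemma coefF_eq: "coefF v k i = (\<Prod>j=1..k-1. v k i - v (k-1) j) / (\<Prod>j\<in>{1..k}-{i}. v k i - v k j)"
  by (simp add: coefF_def Let_def)

text \<open>The two positions influence each other only in the same row, through the denominators,
  or for \<open>l = k + 1\<close>, through the numerators. Numerators and denominators of both sides
  agree separately as products, so the identity also holds where a denominator is 0.\<close>

lemma coef_swap:
  assumes i: "i \<in> {1..k}" and j: "j \<in> {1..l}" and ne: "(k, i) \<noteq> (l, j)"
  shows "coefE (shift u l j (-1)) k i * coefF u l j = coefF (shift u k i 1) l j * coefE u k i"
proof -
  have split_one: "(\<Prod>s\<in>A. f s) = f r * (\<Prod>s\<in>A - {r}. f s)" if "r \<in> A" "finite A"
    for r and f :: "nat \<Rightarrow> complex" and A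
    using that by (subst prod.remove[of _ r]) auto
  consider "l = k" "i \<noteq> j" | "l = k + 1" | "l \<noteq> k" "l \<noteq> k + 1" using ne by blast
  thus ?thesis
  proof cases
    case 1
    define x y where "x = u k i" and "y = u k j"
    define R1 where "R1 = (\<Prod>s\<in>{1..k}-{i}-{j}. x - u k s)"
    define R2 where "R2 = (\<Prod>s\<in>{1..k}-{j}-{i}. y - u k s)"
    have a: "j \<in> {1..k} - {i}" "i \<in> {1..k} - {j}" using 1 i j by auto
    have d1: "(\<Prod>s\<in>{1..k}-{i}. shift u k j (-1) k i - shift u k j (-1) k s) = (x - y + 1) * R1"
      using 1 unfolding R1_def by (subst split_one[OF a(1)]) (auto simp: shift_apply x_def y_def intro!: prod.cong)
    have d2: "(\<Prod>s\<in>{1..k}-{i}. u k i - u k s) = (x - y) * R1"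
      unfolding R1_def by (subst split_one[OF a(1)]) (auto simp: x_def y_def)
    have d3: "(\<Prod>s\<in>{1..k}-{j}. shift u k i 1 k j - shift u k i 1 k s) = (y - x - 1) * R2"
      using 1 unfolding R2_def by (subst split_one[OF a(2)]) (auto simp: shift_apply x_def y_def intro!: prod.cong)
    have d4: "(\<Prod>s\<in>{1..k}-{j}. u k j - u k s) = (y - x) * R2"
      unfolding R2_def by (subst split_one[OF a(2)]) (auto simp: x_def y_def)
    have n1: "(\<Prod>s=1..k+1. shift u k j (-1) k i - shift u k j (-1) (k+1) s) = (\<Prod>s=1..k+1. u k i - u (k+1) s)"
      using 1 by (intro prod.cong) (auto simp: shift_apply)
    have n2: "(\<Prod>s=1..k-1. shift u k i 1 k j - shift u k i 1 (k-1) s) = (\<Prod>s=1..k-1. u k j - u (k-1) s)"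
      using 1 i by (intro prod.cong) (auto simp: shift_apply)
    have "((x - y + 1) * R1) * ((y - x) * R2) = ((y - x - 1) * R2) * ((x - y) * R1)"
      by (simp add: algebra_simps)
    thus ?thesis unfolding 1(1) coefE_eq coefF_eq d1 d2 d3 d4 n1 n2
      by (simp only: times_divide_times_eq mult.commute)
  next
    case 2
    define x y where "x = u k i" and "y = u (k+1) j"
    define R1 where "R1 = (\<Prod>s\<in>{1..k+1}-{j}. x - u (k+1) s)"
    define R2 where "R2 = (\<Prod>s\<in>{1..k}-{i}. y - u k s)"
    have a: "j \<in> {1..k+1}" using 2 j by auto
    have d1: "(\<Prod>s\<in>{1..k}-{i}. shift u (k+1) j (-1) k i - shift u (k+1) j (-1) k s) = (\<Prod>s\<in>{1..k}-{i}. u k i - u k s)"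
      by (intro prod.cong) (auto simp: shift_apply)
    have d3: "(\<Prod>s\<in>{1..k+1}-{j}. shift u k i 1 (k+1) j - shift u k i 1 (k+1) s) = (\<Prod>s\<in>{1..k+1}-{j}. u (k+1) j - u (k+1) s)"
      by (intro prod.cong) (auto simp: shift_apply)
    have n1: "(\<Prod>s=1..k+1. shift u (k+1) j (-1) k i - shift u (k+1) j (-1) (k+1) s) = (x - y + 1) * R1"
      unfolding R1_def by (subst split_one[OF a]) (auto simp: shift_apply x_def y_def intro!: prod.cong)
    have n2: "(\<Prod>s=1..k+1. u k i - u (k+1) s) = (x - y) * R1"
      unfolding R1_def by (subst split_one[OF a]) (auto simp: x_def y_def)
    have n3: "(\<Prod>s=1..k+1-1. shift u k i 1 (k+1) j - shift u k i 1 (k+1-1) s) = (y - x - 1) * R2"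
      unfolding R2_def add_diff_cancel_right'
      by (subst split_one[OF i]) (auto simp: shift_apply x_def y_def intro!: prod.cong)
    have n4: "(\<Prod>s=1..k+1-1. u (k+1) j - u (k+1-1) s) = (y - x) * R2"
      unfolding R2_def add_diff_cancel_right' by (subst split_one[OF i]) (auto simp: x_def y_def)
    have "((x - y + 1) * R1) * ((y - x) * R2) = ((y - x - 1) * R2) * ((x - y) * R1)"
      by (simp add: algebra_simps)
    thus ?thesis unfolding 2(1) coefE_eq coefF_eq d1 d3 n1 n2 n3 n4
      by (simp only: times_divide_times_eq mult.commute)
  next
    case 3
    have "coefE (shift u l j (-1)) k i = coefE u k i"
      using 3 by (simp add: coefE_def shift_def)
    moreover have "coefF (shift u k i 1) l j = coefF u l j"
    proof -
      have "l - 1 \<noteq> k" using 3 j by auto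
      thus ?thesis using 3 by (simp add: coefF_def shift_def)
    qed
    ultimately show ?thesis by simp
  qed
qed

definition gt_weight :: "nat \<Rightarrow> gtarr \<Rightarrow> complex" where
  "gt_weight k v = 2 * (\<Sum>i=1..k. v k i) - (\<Sum>i=1..k-1. v (k-1) i) - (\<Sum>i=1..k+1. v (k+1) i) - 1"

definition unit_fun :: "gtarr \<Rightarrow> gtarr \<Rightarrow> complex" where
  "unit_fun v = (\<lambda>w. if w = v then 1 else 0)"

section \<open>Arrays over a dominant top row and the moves that stay in \<open>S\<close>\<close>

locale dominant_row =
  fixes n :: nat and m :: "nat \<Rightarrow> complex"
  assumes n: "n \<ge> 1"
    and dom: "\<And>i j. 1 \<le> i \<Longrightarrow> i < j \<Longrightarrow> j \<le> n + 1 \<Longrightarrow> rp (m i) = rp (m j) \<Longrightarrow> ip (m j) < ip (m i)"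
begin

text \<open>All later columns of the same class modulo integers are compared, not only
  \<open>i + 1\<close>, because columns of other classes may stand between. The lower bound is
  strict because the entries carry the shift by rho.\<close>

definition interlacing :: "(nat \<Rightarrow> nat \<Rightarrow> int) \<Rightarrow> bool" where
  "interlacing z \<longleftrightarrow> (\<forall>k\<in>{1..n}. \<forall>i\<in>{1..k}. z k i \<le> z (k+1) i \<and>
     (\<forall>j\<in>{i<..k+1}. rp (m i) = rp (m j) \<longrightarrow> z (k+1) j < z k i))"

definition S :: "gtarr set" where
  "S = {v \<in> gt_arrays n. (\<forall>i\<in>{1..n+1}. v (n+1) i = m i) \<and>
     (\<forall>k\<in>{1..n}. \<forall>i\<in>{1..k}. rp (v k i) = rp (m i)) \<and> interlacing (\<lambda>k i. ip (v k i))}"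

lemma S_rp:
  assumes "v \<in> S" "1 \<le> i" "i \<le> k" "k \<le> n + 1"
  shows "rp (v k i) = rp (m i)"
  using assms by (cases "k = n + 1") (auto simp: S_def)

lemma S_le:
  assumes "v \<in> S" "1 \<le> i" "i \<le> k" "k \<le> n"
  shows "ip (v k i) \<le> ip (v (k+1) i)"
  using assms by (auto simp: S_def interlacing_def)

lemma S_less:
  assumes "v \<in> S" "1 \<le> i" "i \<le> k" "k \<le> n" "i < j" "j \<le> k + 1" "rp (m i) = rp (m j)"
  shows "ip (v (k+1) j) < ip (v k i)"
  using assms by (auto simp: S_def interlacing_def)

lemma S_less_below:
  assumes "v \<in> S" "1 \<le> j" "j < i" "i \<le> k" "k \<le> n + 1" "rp (m j) = rp (m i)"
  shows "ip (v k i) < ip (v (k-1) j)"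
  using S_less[of v j "k - 1" i] assms by auto

lemma S_le_below:
  assumes "v \<in> S" "1 \<le> i" "i < k" "k \<le> n + 1"
  shows "ip (v (k-1) i) \<le> ip (v k i)"
  using S_le[of v i "k - 1"] assms by auto

lemma S_row:
  assumes v: "v \<in> S" and "1 \<le> i" "i < j" "j \<le> k" "k \<le> n + 1" "rp (m i) = rp (m j)"
  shows "ip (v k j) < ip (v k i)"
proof (cases "k = n + 1")
  case True
  thus ?thesis using assms dom[of i j] by (auto simp: S_def)
next
  case False
  thus ?thesis using S_le[OF v, of j k] S_less[OF v, of i k j] assms by auto
qed

lemma S_row_distinct:
  assumes v: "v \<in> S" and "i \<in> {1..k}" "j \<in> {1..k}" "i \<noteq> j" "k \<le> n + 1"
  shows "v k i \<noteq> v k j"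
proof
  assume "v k i = v k j"
  hence e: "ip (v k i) = ip (v k j)" and "rp (v k i) = rp (v k j)" by auto
  hence "rp (m i) = rp (m j)" using S_rp[OF v] assms by auto
  thus False using S_row[OF v, of i j k] S_row[OF v, of j i k] assms e
    by (cases "i < j") auto
qed

text \<open>Entry \<open>(k, i)\<close> is compared only with its own column in the rows
  \<open>k+1\<close> and \<open>k-1\<close>, with later columns in row \<open>k+1\<close> and with
  earlier columns in row \<open>k-1\<close>; every other condition is inherited from
  \<open>v\<close>.\<close>

lemma shift_in_S_iff:
  assumes v: "v \<in> S" and k: "k \<in> {1..n}" and i: "i \<in> {1..k}"
  shows "shift v k i (of_int t) \<in> S \<longleftrightarrow>
    ip (v k i) + t \<le> ip (v (k+1) i) \<and> (i < k \<longrightarrow> ip (v (k-1) i) \<le> ip (v k i) + t) \<and>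
    (\<forall>j\<in>{i<..k+1}. rp (m i) = rp (m j) \<longrightarrow> ip (v (k+1) j) < ip (v k i) + t) \<and>
    (\<forall>j\<in>{1..<i}. rp (m j) = rp (m i) \<longrightarrow> ip (v k i) + t < ip (v (k-1) j))" (is "_ \<longleftrightarrow> ?R")
proof -
  let ?w = "shift v k i (of_int t)"
  let ?z = "\<lambda>r s. if r = k \<and> s = i then ip (v k i) + t else ip (v r s)"
  have z: "(\<lambda>r s. ip (?w r s)) = ?z" by (auto simp: shift_apply fun_eq_iff)
  have "?w \<in> S \<longleftrightarrow> interlacing ?z"
    using v k i unfolding S_def by (auto simp: z) (auto simp: shift_apply gt_arrays_def)
  also have "\<dots> \<longleftrightarrow> ?R"
  proof
    assume I: "interlacing ?z"
    have A: "?z r s \<le> ?z (r+1) s" if "1 \<le> s" "s \<le> r" "r \<le> n" for r s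
      using I that unfolding interlacing_def by auto
    have B: "?z (r+1) j < ?z r s" if "1 \<le> s" "s \<le> r" "r \<le> n" "s < j" "j \<le> r + 1" "rp (m s) = rp (m j)" for r s j
      using I that unfolding interlacing_def by auto
    have 1: "ip (v k i) + t \<le> ip (v (k+1) i)" using A[of i k] k i by auto
    have 2: "ip (v (k-1) i) \<le> ip (v k i) + t" if "i < k" using A[of i "k-1"] that k i by (cases k) auto
    have 3: "ip (v (k+1) j) < ip (v k i) + t" if "j \<in> {i<..k+1}" "rp (m i) = rp (m j)" for j
      using B[of i k j] that k i by auto
    have 4: "ip (v k i) + t < ip (v (k-1) j)" if "j \<in> {1..<i}" "rp (m j) = rp (m i)" for j
      using B[of j "k-1" i] that k i by auto
    show ?R using 1 2 3 4 by blast
  next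
    assume R: ?R
    show "interlacing ?z" unfolding interlacing_def
    proof (intro ballI conjI impI)
      fix r s assume "r \<in> {1..n}" "s \<in> {1..r}"
      thus "?z r s \<le> ?z (r+1) s" using S_le[OF v, of s r] R by auto
    next
      fix r s j assume "r \<in> {1..n}" "s \<in> {1..r}" "j \<in> {s<..r+1}" "rp (m s) = rp (m j)"
      thus "?z (r+1) j < ?z r s" using S_less[OF v, of s r j] R by auto
    qed
  qed
  finally show ?thesis .
qed

lemmas up_in_S_iff = shift_in_S_iff[where t = 1, unfolded of_int_1]
lemmas down_in_S_iff = shift_in_S_iff[where t = "-1", unfolded of_int_minus of_int_1]

text \<open>The first alternative makes \<open>coefE v k i\<close> vanish, the second the
  coefficient of lowering back. In the second case \<open>coefE v k i\<close> itself can be nonzero,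
  so only the product is controlled.\<close>

lemma up_not_in_S:
  assumes v: "v \<in> S" and k: "k \<in> {1..n}" and i: "i \<in> {1..k}" and "shift v k i 1 \<notin> S"
  shows "v k i = v (k+1) i \<or> (\<exists>j\<in>{1..<i}. v k i + 1 = v (k-1) j)"
proof -
  have "ip (v k i) \<ge> ip (v (k+1) i) \<or> (\<exists>j\<in>{1..<i}. rp (m j) = rp (m i) \<and> ip (v k i) + 1 \<ge> ip (v (k-1) j))"
    using assms(4) S_le_below[OF v, of i k] S_less[OF v, of i k] k i
    unfolding up_in_S_iff[OF v k i] by force
  thus ?thesis
  proof (elim disjE bexE conjE)
    assume "ip (v k i) \<ge> ip (v (k+1) i)"
    hence "v k i = v (k+1) i"
      using S_le[OF v, of i k] S_rp[OF v, of i k] S_rp[OF v, of i "k+1"] k i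
      by - (rule rp_ip_eqI, auto)
    thus ?thesis ..
  next
    fix j assume j: "j \<in> {1..<i}" "rp (m j) = rp (m i)" "ip (v k i) + 1 \<ge> ip (v (k-1) j)"
    hence "v k i + 1 = v (k-1) j"
      using S_less_below[OF v, of j i k] S_rp[OF v, of i k] S_rp[OF v, of j "k-1"] k i
      by - (rule rp_ip_eqI, auto)
    thus ?thesis using j by blast
  qed
qed

text \<open>Mirror image: the first alternative annihilates \<open>coefF v k i\<close>, the second
  the coefficient of raising back.\<close>

lemma down_not_in_S:
  assumes v: "v \<in> S" and k: "k \<in> {1..n}" and i: "i \<in> {1..k}" and "shift v k i (-1) \<notin> S"
  shows "(i < k \<and> v k i = v (k-1) i) \<or> (\<exists>j\<in>{i<..k+1}. v k i - 1 = v (k+1) j)"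
proof -
  have "(i < k \<and> ip (v k i) \<le> ip (v (k-1) i)) \<or> (\<exists>j\<in>{i<..k+1}. rp (m i) = rp (m j) \<and> ip (v k i) - 1 \<le> ip (v (k+1) j))"
    using assms(4) S_le[OF v, of i k] S_less_below[OF v, of _ i k] k i
    unfolding down_in_S_iff[OF v k i] by force
  thus ?thesis
  proof (elim disjE bexE conjE)
    assume "i < k" "ip (v k i) \<le> ip (v (k-1) i)"
    hence "v k i = v (k-1) i"
      using S_le_below[OF v, of i k] S_rp[OF v, of i k] S_rp[OF v, of i "k-1"] k i
      by - (rule rp_ip_eqI, auto)
    thus ?thesis using \<open>i < k\<close> by blast
  next
    fix j assume j: "j \<in> {i<..k+1}" "rp (m i) = rp (m j)" "ip (v k i) - 1 \<le> ip (v (k+1) j)"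
    hence "v k i - 1 = v (k+1) j"
      using S_less[OF v, of i k j] S_rp[OF v, of i k] S_rp[OF v, of j "k+1"] k i
      by - (rule rp_ip_eqI, auto)
    thus ?thesis using j by blast
  qed
qed

text \<open>Every defining inequality of \<open>S\<close> bounds a difference of two entries, so the two
  intermediate arrays of a raise-and-lower move between members of \<open>S\<close> are again in \<open>S\<close>.\<close>
lemma intermediate_in_S:
  assumes u: "u \<in> S" and k: "k \<in> {1..n}" and i: "i \<in> {1..k}" and l: "l \<in> {1..n}" and j: "j \<in> {1..l}"
    and ne: "(k, i) \<noteq> (l, j)" and w: "shift (shift u l j (-1)) k i 1 \<in> S"
  shows "shift u l j (-1) \<in> S" "shift u k i 1 \<in> S"
proof -
  let ?w = "shift (shift u l j (-1)) k i 1"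
  have wv: "ip (?w r s) = ip (u r s) + (if r = k \<and> s = i then 1 else 0) - (if r = l \<and> s = j then 1 else 0)" for r s
    using ne by (auto simp: shift_apply)
  show "shift u l j (-1) \<in> S"
    unfolding down_in_S_iff[OF u l j]
  proof (intro conjI impI ballI)
    show "ip (u l j) + - 1 \<le> ip (u (l + 1) j)"
      using S_le[OF u, of j l] l j by auto
    show "ip (u (l - 1) j) \<le> ip (u l j) + - 1" if "j < l"
      using S_le_below[OF w, of j l] l j that ne unfolding wv by (auto split: if_splits)
    show "ip (u (l + 1) s) < ip (u l j) + - 1" if "s \<in> {j<..l+1}" "rp (m j) = rp (m s)" for s
      using S_less[OF w, of j l s] l j that ne unfolding wv by (auto split: if_splits)
    show "ip (u l j) + - 1 < ip (u (l - 1) s)" if "s \<in> {1..<j}" "rp (m s) = rp (m j)" for s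
      using S_less_below[OF u, of s j l] l j that by auto
  qed
  show "shift u k i 1 \<in> S"
    unfolding up_in_S_iff[OF u k i]
  proof (intro conjI impI ballI)
    show "ip (u k i) + 1 \<le> ip (u (k + 1) i)"
      using S_le[OF w, of i k] k i ne unfolding wv by (auto split: if_splits)
    show "ip (u (k - 1) i) \<le> ip (u k i) + 1" if "i < k"
      using S_le_below[OF u, of i k] k i that by auto
    show "ip (u (k + 1) s) < ip (u k i) + 1" if "s \<in> {i<..k+1}" "rp (m i) = rp (m s)" for s
      using S_less[OF u, of i k s] k i that by auto
    show "ip (u k i) + 1 < ip (u (k - 1) s)" if "s \<in> {1..<i}" "rp (m s) = rp (m i)" for s
      using S_less_below[OF w, of s i k] k i that ne unfolding wv by (auto split: if_splits)
  qed
qed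

section \<open>The operators on the model and their commutators\<close>

text \<open>A function \<open>f\<close> stands for the combination of the \<open>T(v)\<close> with
  coefficients \<open>f v\<close>. Its image at \<open>w\<close> therefore collects the arrays from
  which one unit move leads to \<open>w\<close>, and the test on \<open>w\<close> discards moves
  that leave \<open>S\<close>.\<close>

definition opE :: "nat \<Rightarrow> (gtarr \<Rightarrow> complex) \<Rightarrow> gtarr \<Rightarrow> complex" where
  "opE k f w = (if w \<in> S then - (\<Sum>i=1..k. coefE (shift w k i (-1)) k i * f (shift w k i (-1))) else 0)"

definition opF :: "nat \<Rightarrow> (gtarr \<Rightarrow> complex) \<Rightarrow> gtarr \<Rightarrow> complex" where
  "opF k f w = (if w \<in> S then (\<Sum>i=1..k. coefF (shift w k i 1) k i * f (shift w k i 1)) else 0)"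

definition opH :: "nat \<Rightarrow> (gtarr \<Rightarrow> complex) \<Rightarrow> gtarr \<Rightarrow> complex" where
  "opH k f w = gt_weight k w * f w"

lemma sum_coef_diagonal:
  assumes w: "w \<in> S" and k: "k \<in> {1..n}"
  shows "(\<Sum>i=1..k. (if shift w k i 1 \<in> S then coefE w k i * coefF (shift w k i 1) k i else 0)
      - (if shift w k i (-1) \<in> S then coefE (shift w k i (-1)) k i * coefF w k i else 0)) = gt_weight k w"
proof -
  have rw: "rp (w r s) = rp (m s)" if "1 \<le> s" "s \<le> r" "r \<le> k + 1" for r s using S_rp[OF w] that k by auto
  have "(if shift w k i 1 \<in> S then coefE w k i * coefF (shift w k i 1) k i else 0)
      - (if shift w k i (-1) \<in> S then coefE (shift w k i (-1)) k i * coefF w k i else 0)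
      = gt_commutator k (w (k+1)) (w (k-1)) (w k) i" if i: "i \<in> {1..k}" for i
  proof -
    have E1: "coefE (shift w k i (-1)) k i = (\<Prod>j=1..k+1. w k i - 1 - w (k+1) j) / (\<Prod>j\<in>{1..k}-{i}. w k i - 1 - w k j)"
      unfolding coefE_eq by (intro arg_cong2[where f = "(/)"] prod.cong refl) (auto simp: shift_apply)
    have F1: "coefF (shift w k i 1) k i = (\<Prod>j=1..k-1. w k i + 1 - w (k-1) j) / (\<Prod>j\<in>{1..k}-{i}. w k i + 1 - w k j)"
      unfolding coefF_eq using k by (intro arg_cong2[where f = "(/)"] prod.cong refl) (auto simp: shift_apply)
    have z1: "coefE w k i * coefF (shift w k i 1) k i = 0" if "shift w k i 1 \<notin> S"
      using up_not_in_S[OF w k i that]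
    proof (elim disjE bexE)
      assume "w k i = w (k+1) i"
      hence "(\<Prod>j=1..k+1. w k i - w (k+1) j) = 0" using i by (intro prod_zero) auto
      thus ?thesis by (simp add: coefE_eq)
    next
      fix j assume "j \<in> {1..<i}" "w k i + 1 = w (k-1) j"
      hence "(\<Prod>j=1..k-1. w k i + 1 - w (k-1) j) = 0" using i by (intro prod_zero bexI[of _ j]) auto
      thus ?thesis by (simp add: F1)
    qed
    have z2: "coefE (shift w k i (-1)) k i * coefF w k i = 0" if "shift w k i (-1) \<notin> S"
      using down_not_in_S[OF w k i that]
    proof (elim disjE bexE conjE)
      assume "i < k" "w k i = w (k-1) i"
      hence "(\<Prod>j=1..k-1. w k i - w (k-1) j) = 0" using i by (intro prod_zero bexI[of _ i]) auto
      thus ?thesis by (simp add: coefF_eq)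
    next
      fix j assume "j \<in> {i<..k+1}" "w k i - 1 = w (k+1) j"
      hence "(\<Prod>j=1..k+1. w k i - 1 - w (k+1) j) = 0" using i by (intro prod_zero bexI[of _ j]) auto
      thus ?thesis by (simp add: E1)
    qed
    have "(if shift w k i 1 \<in> S then coefE w k i * coefF (shift w k i 1) k i else 0)
      - (if shift w k i (-1) \<in> S then coefE (shift w k i (-1)) k i * coefF w k i else 0)
      = coefE w k i * coefF (shift w k i 1) k i - coefE (shift w k i (-1)) k i * coefF w k i"
      using z1 z2 by auto
    also have "\<dots> = gt_commutator k (w (k+1)) (w (k-1)) (w k) i"
      unfolding gt_commutator_def E1 F1 unfolding coefE_eq coefF_eq
      by (simp only: times_divide_times_eq mult.commute)
    finally show ?thesis .
  qed
  hence "(\<Sum>i=1..k. (if shift w k i 1 \<in> S then coefE w k i * coefF (shift w k i 1) k i else 0)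
      - (if shift w k i (-1) \<in> S then coefE (shift w k i (-1)) k i * coefF w k i else 0))
      = (\<Sum>i=1..k. gt_commutator k (w (k+1)) (w (k-1)) (w k) i)"
    by (rule sum.cong[OF refl])
  also have "\<dots> = gt_weight k w"
    unfolding gt_weight_def
  proof (rule sum_gt_commutator)
    show "1 \<le> k" using k by simp
    show "w k i \<noteq> w k j" if "i \<in> {1..k}" "j \<in> {1..k}" "i \<noteq> j" for i j
      using S_row_distinct[OF w that] k by simp
    \<comment> \<open>Interlacing squeezes the entry above: it is at least \<open>w k i\<close> and
      strictly below \<open>w k j = w k i + 1\<close>. The other collision is squeezed from below in
      the same way.\<close>
    show "w (k+1) i = w k i" if ij: "i \<in> {1..k}" "j \<in> {1..k}" "i \<noteq> j" and e: "w k i + 1 = w k j" for i j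
    proof -
      have "rp (w k i) = rp (w k j)" and ip: "ip (w k i) + 1 = ip (w k j)" using arg_cong[OF e, of rp] arg_cong[OF e, of ip] by auto
      hence r: "rp (m i) = rp (m j)" using rw ij by auto
      have "j < i" using S_row[OF w, of i j k] r ip ij k by (cases "i < j") auto
      hence "ip (w (k+1) i) = ip (w k i)" using S_less[OF w, of j k i] S_le[OF w, of i k] r ip ij k by auto
      thus ?thesis using rw[of i k] rw[of i "k+1"] ij by - (rule rp_ip_eqI, auto)
    qed
    show "i < k \<and> w (k-1) i = w k i" if ij: "i \<in> {1..k}" "j \<in> {1..k}" "i \<noteq> j" and e: "w k i - 1 = w k j" for i j
    proof -
      have "rp (w k i) = rp (w k j)" and ip: "ip (w k i) - 1 = ip (w k j)" using arg_cong[OF e, of rp] arg_cong[OF e, of ip] by auto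
      hence r: "rp (m i) = rp (m j)" using rw ij by auto
      have lt: "i < j" using S_row[OF w, of j i k] r ip ij k by (cases "j < i") auto
      hence "ip (w (k-1) i) = ip (w k i)" using S_less_below[OF w, of i j k] S_le_below[OF w, of i k] r ip ij k by auto
      thus ?thesis using rw[of i k] rw[of i "k-1"] ij lt by - (rule conjI, simp, rule rp_ip_eqI, auto)
    qed
  qed
  finally show ?thesis .
qed

text \<open>For different positions the two orders of moves lead from the same array
  \<open>u\<close> to \<open>w\<close> and cancel by \<open>coef_swap\<close>; equal positions occur
  only for \<open>k = l\<close> and leave the diagonal sum.\<close>

lemma commutator_opE_opF:
  assumes supp: "\<And>v. v \<notin> S \<Longrightarrow> f v = 0" and k: "k \<in> {1..n}" and l: "l \<in> {1..n}"
  shows "opE k (opF l f) w = opF l (opE k f) w + (if k = l then opH k f w else 0)"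
proof (cases "w \<in> S")
  case False
  thus ?thesis using supp by (simp add: opE_def opF_def opH_def)
next
  case w: True
  define G1 where "G1 i j = (if shift w k i (-1) \<in> S then coefE (shift w k i (-1)) k i *
      (coefF (shift (shift w k i (-1)) l j 1) l j * f (shift (shift w k i (-1)) l j 1)) else 0)" for i j
  define G2 where "G2 i j = (if shift w l j 1 \<in> S then coefF (shift w l j 1) l j *
      (coefE (shift (shift w l j 1) k i (-1)) k i * f (shift (shift w l j 1) k i (-1))) else 0)" for i j
  have e1: "opE k (opF l f) w = - (\<Sum>i=1..k. \<Sum>j=1..l. G1 i j)"
  proof -
    have "coefE (shift w k i (-1)) k i * opF l f (shift w k i (-1)) = (\<Sum>j=1..l. G1 i j)" for i
      by (simp add: opF_def G1_def sum_distrib_left)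
    thus ?thesis using w by (simp add: opE_def)
  qed
  have "opF l (opE k f) w = - (\<Sum>j=1..l. \<Sum>i=1..k. G2 i j)"
  proof -
    have "coefF (shift w l j 1) l j * opE k f (shift w l j 1) = - (\<Sum>i=1..k. G2 i j)" for j
      by (simp add: opE_def G2_def sum_distrib_left)
    thus ?thesis using w by (simp add: opF_def sum_negf)
  qed
  hence e2: "opF l (opE k f) w = - (\<Sum>i=1..k. \<Sum>j=1..l. G2 i j)"
    by (subst sum.swap)
  have G: "G1 i j = G2 i j" if i: "i \<in> {1..k}" and j: "j \<in> {1..l}" and ne: "(k, i) \<noteq> (l, j)" for i j
  proof -
    define u where "u = shift (shift w k i (-1)) l j 1"
    have u2: "u = shift (shift w l j 1) k i (-1)" unfolding u_def by (rule shift_commute)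
    have a: "shift w k i (-1) = shift u l j (-1)" by (simp add: u_def)
    have b: "shift w l j 1 = shift u k i 1" by (simp add: u2)
    \<comment> \<open>For \<open>u\<close> in \<open>S\<close> both intermediate arrays lie in
      \<open>S\<close>, so the two tests agree; otherwise \<open>f u\<close> is 0.\<close>
    show ?thesis
    proof (cases "u \<in> S")
      case True
      have "shift (shift u l j (-1)) k i 1 \<in> S" using w by (simp add: u_def)
      from intermediate_in_S[OF True k i l j ne this]
      have "shift u l j (-1) \<in> S" "shift u k i 1 \<in> S" by auto
      thus ?thesis unfolding G1_def G2_def u_def[symmetric] u2[symmetric] a b
        using coef_swap[OF i j ne, of u] by (simp add: mult.assoc[symmetric])
    next
      case False
      thus ?thesis using supp[OF False] by (simp add: G1_def G2_def flip: u_def u2)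
    qed
  qed
  show ?thesis
  proof (cases "k = l")
    case False
    have "(\<Sum>i=1..k. \<Sum>j=1..l. G1 i j) = (\<Sum>i=1..k. \<Sum>j=1..l. G2 i j)"
      using False by (intro sum.cong refl G) auto
    thus ?thesis using e1 e2 False by simp
  next
    case True
    have "(\<Sum>i=1..k. \<Sum>j=1..l. G2 i j) - (\<Sum>i=1..k. \<Sum>j=1..l. G1 i j) = (\<Sum>i=1..k. \<Sum>j=1..l. G2 i j - G1 i j)"
      by (simp add: sum_subtractf)
    also have "\<dots> = (\<Sum>i=1..k. G2 i i - G1 i i)"
    proof (rule sum.cong[OF refl])
      fix i assume i: "i \<in> {1..k}"
      have "(\<Sum>j=1..l. G2 i j - G1 i j) = (\<Sum>j=1..l. if j = i then G2 i i - G1 i i else 0)"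
        using G i True by (intro sum.cong refl) auto
      thus "(\<Sum>j=1..l. G2 i j - G1 i j) = G2 i i - G1 i i" using i True by simp
    qed
    also have "\<dots> = (\<Sum>i=1..k. (if shift w k i 1 \<in> S then coefE w k i * coefF (shift w k i 1) k i else 0)
      - (if shift w k i (-1) \<in> S then coefE (shift w k i (-1)) k i * coefF w k i else 0)) * f w"
      unfolding sum_distrib_right using True
      by (intro sum.cong refl) (auto simp: G1_def G2_def algebra_simps)
    also have "\<dots> = opH k f w"
      using sum_coef_diagonal[OF w k] by (simp add: opH_def)
    finally have h: "opH k f w = (\<Sum>i=1..k. \<Sum>j=1..l. G2 i j) - (\<Sum>i=1..k. \<Sum>j=1..l. G1 i j)" ..
    show ?thesis unfolding e1 e2 h using True by simp
  qed
qed

lemma gt_weight_shift: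
  assumes "k \<in> {1..n}" "l \<in> {1..n}" "i \<in> {1..l}"
  shows "gt_weight k (shift w l i 1) = gt_weight k w + alpha l (hh k)"
proof -
  have s: "(\<Sum>j=1..r. shift w l i 1 r j) = (\<Sum>j=1..r. w r j) + (if r = l then 1 else 0)" for r
  proof (cases "r = l")
    case True
    have "(\<Sum>j=1..r. shift w l i 1 r j) = (\<Sum>j=1..r. w r j + (if j = i then 1 else 0))"
      using True by (intro sum.cong refl) (auto simp: shift_apply)
    thus ?thesis using True assms by (simp add: sum.distrib)
  next
    case False
    thus ?thesis by (simp add: shift_def)
  qed
  show ?thesis
    unfolding gt_weight_def s using assms
    by (auto simp: alpha_def hh_def madd_def msmult_def Eu_def)
qed

lemma commutator_opH_opF:
  assumes "k \<in> {1..n}" "l \<in> {1..n}"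
  shows "opH k (opF l f) w = opF l (opH k f) w - alpha l (hh k) * opF l f w"
proof (cases "w \<in> S")
  case True
  have "opF l (opH k f) w = (\<Sum>i=1..l. (gt_weight k w + alpha l (hh k)) * (coefF (shift w l i 1) l i * f (shift w l i 1)))"
    using True unfolding opF_def opH_def by (auto intro!: sum.cong simp: gt_weight_shift[OF assms])
  also have "\<dots> = (gt_weight k w + alpha l (hh k)) * opF l f w"
    using True by (simp add: opF_def sum_distrib_left)
  finally show ?thesis by (simp add: opH_def algebra_simps)
qed (simp add: opF_def opH_def)

section \<open>Highest array, kernel of the raising operators, cyclicity\<close>

text \<open>The array of the highest weight vector: every entry is as large as the top row
  permits.\<close>

definition v0 :: gtarr where
  "v0 = (\<lambda>k i. if 1 \<le> i \<and> i \<le> k \<and> k \<le> n + 1 then m i else 0)"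

lemma v0_in_S: "v0 \<in> S"
  using dom by (auto simp: S_def v0_def gt_arrays_def interlacing_def)

lemma gt_weight_v0:
  assumes "k \<in> {1..n}"
  shows "gt_weight k v0 = m k - m (k+1) - 1"
proof -
  have s: "(\<Sum>i=1..r. v0 r i) = (\<Sum>i=1..r. m i)" if "r \<le> n + 1" for r
    using that by (intro sum.cong refl) (auto simp: v0_def)
  obtain r where "k = Suc r" using assms by (cases k) auto
  thus ?thesis using assms unfolding gt_weight_def
    by (subst (1 2 3) s) (auto simp: algebra_simps)
qed

text \<open>The rows up to \<open>k\<close> then form the highest array over row \<open>k\<close>.
  The scale runs from \<open>aligned 1\<close>, which always holds, to \<open>aligned (n+1)\<close>,
  which leaves only \<open>v0\<close> in \<open>S\<close>.\<close>

definition aligned :: "nat \<Rightarrow> gtarr \<Rightarrow> bool" where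
  "aligned k v \<longleftrightarrow> (\<forall>r\<in>{1..k}. \<forall>i\<in>{1..r}. v r i = v k i)"

lemma aligned_one: "aligned 1 v"
  by (auto simp: aligned_def)

lemma aligned_Suc:
  assumes "v \<in> S" "aligned k v" "k \<le> n" "\<And>i. i \<in> {1..k} \<Longrightarrow> \<not> ip (v k i) < ip (v (k+1) i)"
  shows "aligned (k+1) v"
proof -
  have "v k i = v (k+1) i" if "i \<in> {1..k}" for i
    using assms(4)[OF that] S_le[OF assms(1), of i k] S_rp[OF assms(1), of i k] S_rp[OF assms(1), of i "k+1"] that assms(3)
    by - (rule rp_ip_eqI, auto)
  thus ?thesis using assms(2) by (auto simp: aligned_def le_Suc_eq)
qed

lemma aligned_top: "v \<in> S \<Longrightarrow> aligned (n+1) v \<Longrightarrow> v = v0"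
proof (intro ext)
  fix k i assume v: "v \<in> S" "aligned (n+1) v"
  show "v k i = v0 k i"
  proof (cases "1 \<le> i \<and> i \<le> k \<and> k \<le> n + 1")
    case True
    hence "v k i = v (n+1) i" using v(2)[unfolded aligned_def, rule_format, of k i] by simp
    also have "\<dots> = m i" using v True by (auto simp: S_def)
    finally show ?thesis using True by (simp add: v0_def)
  next
    case False
    thus ?thesis using v by (auto simp: S_def gt_arrays_def v0_def)
  qed
qed

lemma aligned_below: "aligned k v \<Longrightarrow> 1 \<le> i \<Longrightarrow> i < k \<Longrightarrow> v (k-1) i = v k i"
  unfolding aligned_def by (drule bspec[of _ _ "k-1"], simp, drule bspec[of _ _ i], simp_all)

text \<open>The bound that could obstruct comes from an earlier column of row \<open>k-1\<close>.
  Alignment makes that entry equal to its neighbour in row \<open>k\<close>, which exceeds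
  \<open>v (k+1) i\<close> by interlacing.\<close>

lemma raise_aligned_in_S:
  assumes v: "v \<in> S" and al: "aligned k v" and k: "k \<in> {1..n}" and i: "i \<in> {1..k}"
    and lt: "ip (v k i) < ip (v (k+1) i)"
  shows "shift v k i 1 \<in> S"
  unfolding up_in_S_iff[OF v k i]
proof (intro conjI impI ballI)
  show "ip (v k i) + 1 \<le> ip (v (k + 1) i)" using lt by simp
  show "ip (v (k - 1) i) \<le> ip (v k i) + 1" if "i < k"
    using S_le_below[OF v, of i k] k i that by auto
  show "ip (v (k + 1) s) < ip (v k i) + 1" if "s \<in> {i<..k+1}" "rp (m i) = rp (m s)" for s
    using S_less[OF v, of i k s] k i that by auto
  show "ip (v k i) + 1 < ip (v (k - 1) s)" if "s \<in> {1..<i}" "rp (m s) = rp (m i)" for s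
    using aligned_below[OF al, of s] S_less[OF v, of s k i] lt k i that by auto
qed

text \<open>At least one of \<open>i\<close>, \<open>j\<close> is below \<open>k\<close>, and in
  that column row \<open>k-1\<close> still holds the old value.\<close>

lemma swap_not_aligned:
  assumes al: "aligned k v" and i: "i \<in> {1..k}" and j: "j \<in> {1..k}" and "i \<noteq> j"
  shows "\<not> aligned k (shift (shift v k i 1) k j (-1))" (is "\<not> aligned k ?w")
proof
  assume al2: "aligned k ?w"
  show False
  proof (cases "i < k")
    case True
    have "?w (k-1) i = ?w k i" using aligned_below[OF al2] i True by auto
    moreover have "?w (k-1) i = v k i" using aligned_below[OF al, of i] i True by (auto simp: shift_apply)
    moreover have "?w k i = v k i + 1" using assms by (auto simp: shift_apply)
    ultimately show False by simp
  next
    case False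
    hence jk: "j < k" using assms by auto
    have "?w (k-1) j = ?w k j" using aligned_below[OF al2] j jk by auto
    moreover have "?w (k-1) j = v k j" using aligned_below[OF al, of j] j jk by (auto simp: shift_apply)
    moreover have "?w k j = v k j - 1" using assms by (auto simp: shift_apply)
    ultimately show False by simp
  qed
qed

lemma coefE_nonzero:
  assumes v: "v \<in> S" and k: "k \<in> {1..n}" and i: "i \<in> {1..k}" and lt: "ip (v k i) < ip (v (k+1) i)"
  shows "coefE v k i \<noteq> 0"
proof -
  have "v k i \<noteq> v (k+1) j" if j: "j \<in> {1..k+1}" for j
  proof
    assume e: "v k i = v (k+1) j"
    hence ip: "ip (v k i) = ip (v (k+1) j)" and "rp (v k i) = rp (v (k+1) j)" by auto
    hence r: "rp (m i) = rp (m j)" using S_rp[OF v, of i k] S_rp[OF v, of j "k+1"] i j k by auto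
    consider "j = i" | "i < j" | "j < i" by linarith
    thus False
    proof cases
      case 1 thus ?thesis using lt ip by simp
    next
      case 2 thus ?thesis using S_less[OF v, of i k j] r ip i j k by auto
    next
      case 3 thus ?thesis using S_row[OF v, of j i "k+1"] lt r ip i j k by auto
    qed
  qed
  moreover have "v k i \<noteq> v k j" if "j \<in> {1..k} - {i}" for j
    using S_row_distinct[OF v i, of j] that k by auto
  ultimately show ?thesis unfolding coefE_eq by auto
qed

text \<open>Within one class modulo integers, alignment puts the entries of row \<open>k-1\<close>
  in columns \<open>j \<ge> i\<close> below the raised value, while earlier columns stay above it
  because the raised array is in \<open>S\<close>.\<close>

lemma coefF_nonzero:
  assumes v: "v \<in> S" and al: "aligned k v" and k: "k \<in> {1..n}" and i: "i \<in> {1..k}" and lt: "ip (v k i) < ip (v (k+1) i)"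
  shows "coefF (shift v k i 1) k i \<noteq> 0"
proof -
  let ?w = "shift v k i 1"
  have w: "?w \<in> S" by (rule raise_aligned_in_S[OF v al k i lt])
  have wk: "?w k i = v k i + 1" by (simp add: shift_apply)
  have "?w k i \<noteq> ?w (k-1) j" if j: "j \<in> {1..k-1}" for j
  proof
    assume e: "?w k i = ?w (k-1) j"
    hence ip: "ip (?w k i) = ip (?w (k-1) j)" and "rp (?w k i) = rp (?w (k-1) j)" by auto
    hence r: "rp (m i) = rp (m j)" using S_rp[OF w, of i k] S_rp[OF w, of j "k-1"] i j k by auto
    have wj: "?w (k-1) j = v k j" using aligned_below[OF al, of j] j by (auto simp: shift_apply)
    consider "j = i" | "i < j" | "j < i" by linarith
    thus False
    proof cases
      case 1 thus ?thesis using ip wj by (simp add: shift_apply)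
    next
      case 2
      moreover have "j \<le> k" using j by auto
      ultimately show ?thesis using S_row[OF v, of i j k] r ip wj wk i k by auto
    next
      case 3 thus ?thesis using S_less_below[OF w, of j i k] r ip i j k by auto
    qed
  qed
  moreover have "?w k i \<noteq> ?w k j" if "j \<in> {1..k} - {i}" for j
    using S_row_distinct[OF w i, of j] that k by auto
  ultimately show ?thesis unfolding coefF_eq by auto
qed

text \<open>Suppose a supporting array \<open>v\<close> has room in row \<open>k+1\<close>, and
  evaluate \<open>opE (k+1) f\<close> at the raised array. The other contributions come from arrays
  not aligned up to \<open>k+1\<close>, where \<open>f\<close> vanishes by induction, so the nonzero
  term of \<open>v\<close> could not cancel. Alignment of the support thus climbs to the top
  row.\<close>

lemma opE_kernel:
  assumes supp: "\<And>v. v \<notin> S \<Longrightarrow> f v = 0" and ker: "\<And>k w. k \<in> {1..n} \<Longrightarrow> opE k f w = 0"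
    and nz: "f v \<noteq> 0"
  shows "v = v0"
proof -
  have "\<forall>v. f v \<noteq> 0 \<longrightarrow> aligned (k+1) v" if "k \<le> n" for k
    using that
  proof (induction k)
    case 0
    thus ?case using aligned_one by simp
  next
    case (Suc k)
    hence IH: "aligned (k+1) v" if "f v \<noteq> 0" for v using that by auto
    have k: "k + 1 \<in> {1..n}" using Suc.prems by auto
    show ?case
    proof (intro allI impI)
      fix v assume nz: "f v \<noteq> 0"
      hence v: "v \<in> S" and al: "aligned (k+1) v" using supp IH by auto
      have "\<not> ip (v (k+1) i) < ip (v (k+1+1) i)" if i: "i \<in> {1..k+1}" for i
      proof
        assume lt: "ip (v (k+1) i) < ip (v (k+1+1) i)"
        let ?w = "shift v (k+1) i 1"
        have w: "?w \<in> S" by (rule raise_aligned_in_S[OF v al k i lt])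
        have "f (shift ?w (k+1) j (-1)) = 0" if "j \<in> {1..k+1}" "j \<noteq> i" for j
          using swap_not_aligned[OF al i that(1)] that(2) IH by blast
        hence "(\<Sum>j=1..k+1. coefE (shift ?w (k+1) j (-1)) (k+1) j * f (shift ?w (k+1) j (-1)))
          = (\<Sum>j=1..k+1. if j = i then coefE v (k+1) i * f v else 0)"
          by (intro sum.cong refl) auto
        hence "opE (k+1) f ?w = - (coefE v (k+1) i * f v)"
          using w i by (simp add: opE_def)
        thus False using ker[OF k] nz coefE_nonzero[OF v k i lt] by simp
      qed
      thus "aligned (Suc k + 1) v" using aligned_Suc[OF v al] k by simp
    qed
  qed
  from this[of n] show ?thesis using nz supp aligned_top by blast
qed

text \<open>For \<open>v\<close> in \<open>S\<close>, the number of unit lowerings that separate it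
  from \<open>v0\<close>.\<close>

definition depth :: "gtarr \<Rightarrow> int" where
  "depth v = (\<Sum>k=1..n. \<Sum>i=1..k. ip (m i) - ip (v k i))"

lemma depth_nonneg:
  assumes v: "v \<in> S"
  shows "depth v \<ge> 0"
proof -
  have "ip (v (n + 1 - d) i) \<le> ip (m i)" if "1 \<le> i" "i \<le> n + 1 - d" for d i
    using that
  proof (induction d)
    case 0
    thus ?case using v by (auto simp: S_def)
  next
    case (Suc d)
    hence "n + 1 - d = n + 1 - Suc d + 1" by auto
    thus ?case using Suc S_le[OF v, of i "n + 1 - Suc d"] by auto
  qed
  note * = this
  have "ip (v k i) \<le> ip (m i)" if "k \<in> {1..n}" "i \<in> {1..k}" for k i
    using *[of i "n + 1 - k"] that by auto
  thus ?thesis unfolding depth_def by (intro sum_nonneg) auto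
qed

lemma depth_shift:
  assumes k: "k \<in> {1..n}" and i: "i \<in> {1..k}"
  shows "depth (shift v k i (of_int t)) = depth v - t"
proof -
  have "depth (shift v k i (of_int t)) = (\<Sum>r=1..n. \<Sum>j=1..r. (ip (m j) - ip (v r j)) - (if r = k then if j = i then t else 0 else 0))"
    unfolding depth_def by (intro sum.cong refl) (auto simp: shift_apply)
  also have "\<dots> = depth v - (\<Sum>r=1..n. if r = k then (\<Sum>j=1..r. if j = i then t else 0) else 0)"
    unfolding depth_def sum_subtractf by (intro arg_cong2[where f = "(-)"] refl sum.cong) auto
  finally show ?thesis using k i by simp
qed

lemmas depth_up = depth_shift[where t = 1, unfolded of_int_1]
lemmas depth_down = depth_shift[where t = "-1", unfolded of_int_minus of_int_1]

lemma opF_unit_fun: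
  "opF k (unit_fun v) w = (\<Sum>i=1..k. coefF v k i * (if shift v k i (-1) \<in> S then unit_fun (shift v k i (-1)) w else 0))"
  by (auto simp: opF_def unit_fun_def shift_eq_iff intro!: sum.cong sum.neutral)

lemma opE_unit_fun:
  "opE k (unit_fun v) w = - (\<Sum>i=1..k. coefE v k i * (if shift v k i 1 \<in> S then unit_fun (shift v k i 1) w else 0))"
  by (auto simp: opE_def unit_fun_def shift_eq_iff intro!: sum.cong sum.neutral)

text \<open>Outer induction on depth, inner induction on the row where alignment first fails.
  Raising \<open>u\<close> at that obstacle gives an array of smaller depth; applying
  \<open>opF\<close> to it returns \<open>u\<close> with a nonzero coefficient, plus arrays of the
  same depth whose alignment fails lower down and which are already in \<open>U\<close>.\<close>

lemma unit_fun_generated: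
  assumes add: "\<And>f g. f \<in> U \<Longrightarrow> g \<in> U \<Longrightarrow> (\<lambda>w. f w + g w) \<in> U"
    and smult: "\<And>c f. f \<in> U \<Longrightarrow> (\<lambda>w. c * f w) \<in> U"
    and F: "\<And>k f. k \<in> {1..n} \<Longrightarrow> f \<in> U \<Longrightarrow> opF k f \<in> U"
    and base: "unit_fun v0 \<in> U"
  shows "v \<in> S \<Longrightarrow> unit_fun v \<in> U"
proof (induction "nat (depth v)" arbitrary: v rule: less_induct)
  case less
  have zero: "(\<lambda>w. 0) \<in> U" using smult[OF base, of 0] by simp
  have sums: "(\<lambda>w. \<Sum>j\<in>J. g j w) \<in> U" if "finite J" "\<And>j. j \<in> J \<Longrightarrow> g j \<in> U" for J :: "nat set" and g
    using that by (induction J rule: finite_induct) (auto simp: zero intro: add)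
  have "\<forall>u\<in>S. depth u = depth v \<and> \<not> aligned (k+1) u \<longrightarrow> unit_fun u \<in> U" if "k \<le> n" for k
    using that
  proof (induction k)
    case 0
    thus ?case using aligned_one by auto
  next
    case (Suc k)
    have k: "k + 1 \<in> {1..n}" using Suc.prems by auto
    show ?case
    proof (intro ballI impI)
      fix u assume u: "u \<in> S" and "depth u = depth v \<and> \<not> aligned (Suc k + 1) u"
      hence deg: "depth u = depth v" and nal: "\<not> aligned (Suc k + 1) u" by auto
      show "unit_fun u \<in> U"
      proof (cases "aligned (k+1) u")
        case False
        thus ?thesis using Suc u deg by auto
      next
        case al: True
        then obtain i where i: "i \<in> {1..k+1}" and lt: "ip (u (k+1) i) < ip (u (k+1+1) i)"
          using aligned_Suc[OF u al] nal k by auto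
        let ?w = "shift u (k+1) i 1"
        have w: "?w \<in> S" by (rule raise_aligned_in_S[OF u al k i lt])
        have "depth ?w = depth v - 1" using depth_up[OF k i] deg by simp
        hence "nat (depth ?w) < nat (depth v)" using depth_nonneg[OF w] by simp
        hence FU: "opF (k+1) (unit_fun ?w) \<in> U" using less.hyps w F[OF k] by blast
        define c where "c j = coefF ?w (k+1) j" for j
        define g where "g j = (if shift ?w (k+1) j (-1) \<in> S then unit_fun (shift ?w (k+1) j (-1)) else (\<lambda>w. 0))" for j
        have gU: "g j \<in> U" if j: "j \<in> {1..k+1} - {i}" for j
        proof (cases "shift ?w (k+1) j (-1) \<in> S")
          case True
          have "depth (shift ?w (k+1) j (-1)) = depth v"
            using depth_up[OF k i] depth_down[OF k, of j] deg j by simp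
          moreover have "\<not> aligned (k+1) (shift ?w (k+1) j (-1))"
            using swap_not_aligned[OF al i, of j] j by auto
          ultimately show ?thesis using True Suc by (auto simp: g_def)
        qed (simp add: g_def zero)
        have "opF (k+1) (unit_fun ?w) w = c i * unit_fun u w + (\<Sum>j\<in>{1..k+1} - {i}. c j * g j w)" for w
        proof -
          have "opF (k+1) (unit_fun ?w) w = (\<Sum>j=1..k+1. c j * g j w)"
            unfolding opF_unit_fun by (intro sum.cong refl) (auto simp: c_def g_def)
          also have "\<dots> = c i * g i w + (\<Sum>j\<in>{1..k+1} - {i}. c j * g j w)"
            using i by (subst sum.remove[of _ i]) auto
          also have "g i = unit_fun u" using u by (simp add: g_def)
          finally show ?thesis .
        qed
        moreover have "c i \<noteq> 0" unfolding c_def by (rule coefF_nonzero[OF u al k i lt])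
        ultimately have eq: "unit_fun u = (\<lambda>w. (1 / c i) * (opF (k+1) (unit_fun ?w) w + (-1) * (\<Sum>j\<in>{1..k+1} - {i}. c j * g j w)))"
          by (auto simp: fun_eq_iff field_simps)
        have "(\<lambda>w. \<Sum>j\<in>{1..k+1} - {i}. c j * g j w) \<in> U"
          by (rule sums, simp) (rule smult, rule gU)
        hence "(\<lambda>w. (1 / c i) * (opF (k+1) (unit_fun ?w) w + (-1) * (\<Sum>j\<in>{1..k+1} - {i}. c j * g j w))) \<in> U"
          by (intro smult add FU)
        thus ?thesis by (subst eq)
      qed
    qed
  qed
  from this[of n] show ?case using less.prems aligned_top base by auto
qed

end

section \<open>Comparison with a simple highest weight module\<close>

lemma lie_moduleD:
  assumes "lie_module n scale \<rho>"
  shows "vector_space scale"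
    and "X \<in> sl n \<Longrightarrow> \<rho> X (a + b) = \<rho> X a + \<rho> X b"
    and "X \<in> sl n \<Longrightarrow> \<rho> X (scale t a) = scale t (\<rho> X a)"
    and "X \<in> sl n \<Longrightarrow> Y \<in> sl n \<Longrightarrow> \<rho> (madd X Y) a = \<rho> X a + \<rho> Y a"
    and "X \<in> sl n \<Longrightarrow> \<rho> (msmult t X) a = scale t (\<rho> X a)"
    and "X \<in> sl n \<Longrightarrow> Y \<in> sl n \<Longrightarrow> \<rho> (bracket n X Y) a = \<rho> X (\<rho> Y a) - \<rho> Y (\<rho> X a)"
  using assms unfolding lie_module_def Vector_Spaces.linear_iff by blast+

lemma chevalley_stable_imp_stable:
  assumes lm: "lie_module n scale \<rho>" and n: "n \<ge> 1" and W: "module.subspace scale W"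
    and st: "\<And>k w. k \<in> {1..n} \<Longrightarrow> w \<in> W \<Longrightarrow> \<rho> (ee k) w \<in> W \<and> \<rho> (ff k) w \<in> W"
    and "X \<in> sl n" "w \<in> W"
  shows "\<rho> X w \<in> W"
proof -
  interpret vs: vector_space scale by (rule lie_moduleD(1)[OF lm])
  define G where "G = {X \<in> sl n. \<forall>w\<in>W. \<rho> X w \<in> W}"
  have "G = sl n"
  proof (rule sl_generated)
    show "G \<subseteq> sl n" by (auto simp: G_def)
    show "madd X Y \<in> G" if "X \<in> G" "Y \<in> G" for X Y
      using that W by (auto simp: G_def madd_in_sl lie_moduleD(4)[OF lm] intro: vs.subspace_add)
    show "msmult t X \<in> G" if "X \<in> G" for t X
      using that W by (auto simp: G_def msmult_in_sl lie_moduleD(5)[OF lm] intro: vs.subspace_scale)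
    show "bracket n X Y \<in> G" if "X \<in> G" "Y \<in> G" for X Y
      using that W by (auto simp: G_def bracket_in_sl lie_moduleD(6)[OF lm] intro: vs.subspace_diff)
    show "ee k \<in> G \<and> ff k \<in> G" if "k \<in> {1..n}" for k
      using st[OF that] that by (auto simp: G_def ee_in_sl ff_in_sl)
  qed (rule n)
  thus ?thesis using assms(5,6) by (auto simp: G_def)
qed

text \<open>Apply \<open>L\<close> minus its last eigenvalue: the last summand disappears and every
  other one is multiplied by a nonzero scalar.\<close>

lemma eigenvectors_sum_zero:
  fixes scale :: "complex \<Rightarrow> 'v::ab_group_add \<Rightarrow> 'v"
  assumes "vector_space scale"
    and add: "\<And>a b. L (a + b) = L a + L b" and smult: "\<And>t a. L (scale t a) = scale t (L a)"
    and eig: "\<And>j. L (y j) = scale (\<mu> - of_nat j) (y j)"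
    and sum0: "(\<Sum>j\<le>D. y j) = 0" and "j \<le> D"
  shows "y j = 0"
proof -
  interpret vs: vector_space scale by fact
  have L0: "L 0 = 0" using add[of 0 0] by simp
  have Lsum: "L (\<Sum>j\<in>A. y j) = (\<Sum>j\<in>A. L (y j))" if "finite A" for A and y :: "nat \<Rightarrow> 'v"
    using that by (induction A rule: finite_induct) (auto simp: L0 add)
  show ?thesis
    using eig sum0 \<open>j \<le> D\<close>
  proof (induction D arbitrary: y j)
    case 0
    thus ?case by simp
  next
    case (Suc D)
    define z where "z j = scale (of_nat (Suc D) - of_nat j) (y j)" for j
    have "(\<Sum>j\<le>Suc D. z j) = (\<Sum>j\<le>Suc D. L (y j)) - (\<Sum>j\<le>Suc D. scale (\<mu> - of_nat (Suc D)) (y j))"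
      unfolding sum_subtractf[symmetric] z_def Suc.prems(1)
      by (intro sum.cong refl) (simp add: vs.scale_left_diff_distrib[symmetric])
    also have "\<dots> = L (\<Sum>j\<le>Suc D. y j) - scale (\<mu> - of_nat (Suc D)) (\<Sum>j\<le>Suc D. y j)"
      by (simp only: Lsum[OF finite_atMost] vs.scale_sum_right)
    also have "\<dots> = 0" by (simp only: Suc.prems(2) L0 vs.scale_zero_right diff_self)
    finally have "(\<Sum>j\<le>D. z j) = 0" by (simp add: z_def)
    moreover have "L (z j) = scale (\<mu> - of_nat j) (z j)" for j
      by (simp add: z_def smult Suc.prems(1) mult.commute)
    ultimately have "z j = 0" if "j \<le> D" for j using Suc.IH that by blast
    moreover have "of_nat (Suc D) - of_nat j \<noteq> (0::complex)" if "j \<le> D" for j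
      using that by (simp del: of_nat_Suc)
    ultimately have low: "y j = 0" if "j \<le> D" for j
      using that by (metis vs.scale_eq_0_iff z_def)
    hence "y (Suc D) = 0" using Suc.prems(2) by simp
    thus ?case using low Suc.prems(3) by (auto simp: le_Suc_eq)
  qed
qed

section \<open>The graph of the isomorphism between module and model\<close>

locale gt_highest_weight = dominant_row n m for n :: nat and m :: "nat \<Rightarrow> complex" +
  fixes scale :: "complex \<Rightarrow> 'v::ab_group_add \<Rightarrow> 'v" and \<rho> :: "mat \<Rightarrow> 'v \<Rightarrow> 'v"
    and c :: "nat \<Rightarrow> complex" and x :: 'v
  assumes simple: "simple_module n scale \<rho>"
    and x0: "x \<noteq> 0"
    and killed: "\<And>X. X \<in> nplus n \<Longrightarrow> \<rho> X x = 0"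
    and weight: "\<And>H. H \<in> cartan n \<Longrightarrow> \<rho> H x = scale (wt_fun n c H) x"
    and c_eq: "\<And>k. k \<in> {1..n} \<Longrightarrow> c k = m k - m (k+1) - 1"
begin

lemma lm: "lie_module n scale \<rho>"
  using simple by (simp add: simple_module_def)

sublocale vs: vector_space scale
  by (rule lie_moduleD(1)[OF lm])

lemmas rho_add = lie_moduleD(2)[OF lm]
lemmas rho_scale = lie_moduleD(3)[OF lm]

lemma rho_zero: "X \<in> sl n \<Longrightarrow> \<rho> X 0 = 0"
  using rho_scale[of X 0 0] by simp

lemma ef_commute:
  assumes "k \<in> {1..n}" "l \<in> {1..n}"
  shows "\<rho> (ee k) (\<rho> (ff l) a) = \<rho> (ff l) (\<rho> (ee k) a) + (if k = l then \<rho> (hh k) a else 0)"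
proof -
  have "\<rho> (bracket n (ee k) (ff l)) a = \<rho> (ee k) (\<rho> (ff l) a) - \<rho> (ff l) (\<rho> (ee k) a)"
    using assms by (intro lie_moduleD(6)[OF lm] ee_in_sl ff_in_sl)
  moreover have "\<rho> (bracket n (ee k) (ff l)) a = (if k = l then \<rho> (hh k) a else 0)"
    using assms by (simp add: bracket_ee_ff lie_moduleD(5)[OF lm] ee_in_sl)
  ultimately show ?thesis by (simp add: algebra_simps)
qed

lemma cartan_f_commute:
  assumes "H \<in> cartan n" "l \<in> {1..n}"
  shows "\<rho> H (\<rho> (ff l) a) = \<rho> (ff l) (\<rho> H a) + scale (- alpha l H) (\<rho> (ff l) a)"
proof -
  have "\<rho> (bracket n H (ff l)) a = \<rho> H (\<rho> (ff l) a) - \<rho> (ff l) (\<rho> H a)"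
    using assms cartan_subset_sl by (intro lie_moduleD(6)[OF lm] ff_in_sl) auto
  moreover have "\<rho> (bracket n H (ff l)) a = scale (- alpha l H) (\<rho> (ff l) a)"
    unfolding bracket_cartan_ff[OF assms] using assms by (simp only: lie_moduleD(5)[OF lm] ff_in_sl)
  ultimately show ?thesis by (simp add: algebra_simps)
qed

text \<open>The submodule of the direct sum of the given module and the Gelfand--Tsetlin model that is
  generated by the pair of highest weight vectors; it turns out to be the graph of an isomorphism.\<close>
inductive N :: "'v \<Rightarrow> (gtarr \<Rightarrow> complex) \<Rightarrow> bool" where
  base: "N x (unit_fun v0)"
| add: "N a f \<Longrightarrow> N b g \<Longrightarrow> N (a + b) (\<lambda>w. f w + g w)"
| smult: "N a f \<Longrightarrow> N (scale t a) (\<lambda>w. t * f w)"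
| lower: "k \<in> {1..n} \<Longrightarrow> N a f \<Longrightarrow> N (\<rho> (ff k) a) (opF k f)"

lemma N_zero: "N 0 (\<lambda>w. 0)"
  using N.smult[OF N.base, of 0] by simp

lemma N_diff: "N a f \<Longrightarrow> N b g \<Longrightarrow> N (a - b) (\<lambda>w. f w - g w)"
  using N.add[OF _ N.smult[of b g "-1"], of a f] by simp

lemma N_sum: "finite A \<Longrightarrow> (\<And>i. i \<in> A \<Longrightarrow> N (a i) (g i)) \<Longrightarrow> N (\<Sum>i\<in>A. a i) (\<lambda>w. \<Sum>i\<in>A. g i w)"
proof (induction A rule: finite_induct)
  case (insert i A)
  have "N (a i + (\<Sum>i\<in>A. a i)) (\<lambda>w. g i w + (\<Sum>i\<in>A. g i w))"
    using insert by (intro N.add) simp_all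
  thus ?case using insert.hyps by simp
qed (simp add: N_zero)

lemma N_supp: "N a f \<Longrightarrow> v \<notin> S \<Longrightarrow> f v = 0"
proof (induction rule: N.induct)
  case base
  thus ?case using v0_in_S by (auto simp: unit_fun_def)
qed (auto simp: opF_def)

text \<open>Guarantees that a maximal depth exists and that expansions in the basis are finite
  sums.\<close>

lemma N_finite: "N a f \<Longrightarrow> finite {v. f v \<noteq> 0}"
proof (induction rule: N.induct)
  case base
  show ?case by (simp add: unit_fun_def)
next
  case (add a f b g)
  show ?case by (rule finite_subset[OF _ finite_UnI[OF add.IH]]) auto
next
  case (smult a f t)
  show ?case by (rule finite_subset[OF _ smult.IH]) auto
next
  case (lower k a f)
  have "w \<in> (\<Union>i\<in>{1..k}. (\<lambda>v. shift v k i (-1)) ` {v. f v \<noteq> 0})" if w: "opF k f w \<noteq> 0" for w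
  proof -
    obtain i where i: "i \<in> {1..k}" "f (shift w k i 1) \<noteq> 0"
      using w by (auto simp: opF_def split: if_splits elim!: sum.not_neutral_contains_not_neutral)
    moreover have "w = shift (shift w k i 1) k i (-1)" by simp
    ultimately show ?thesis by blast
  qed
  hence "{w. opF k f w \<noteq> 0} \<subseteq> (\<Union>i\<in>{1..k}. (\<lambda>v. shift v k i (-1)) ` {v. f v \<noteq> 0})" by blast
  moreover have "finite (\<Union>i\<in>{1..k}. (\<lambda>v. shift v k i (-1)) ` {v. f v \<noteq> 0})" using lower.IH by simp
  ultimately show ?case by (rule finite_subset)
qed

lemma opE_add: "opE k (\<lambda>w. f w + g w) = (\<lambda>w. opE k f w + opE k g w)"
  by (auto simp: opE_def fun_eq_iff algebra_simps sum.distrib)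

lemma opE_smult: "opE k (\<lambda>w. t * f w) = (\<lambda>w. t * opE k f w)"
  by (auto simp: opE_def fun_eq_iff sum_distrib_left mult_ac)

lemma N_weight_op:
  assumes k: "k \<in> {1..n}"
  shows "N a f \<Longrightarrow> N (\<rho> (hh k) a) (opH k f)"
proof (induction rule: N.induct)
  case base
  have "\<rho> (hh k) x = scale (gt_weight k v0) x"
    using weight[OF hh_in_cartan[OF k]] wt_fun_hh[OF k] c_eq[OF k] gt_weight_v0[OF k] by simp
  moreover have "opH k (unit_fun v0) = (\<lambda>w. gt_weight k v0 * unit_fun v0 w)"
    by (auto simp: opH_def unit_fun_def)
  ultimately show ?case using N.smult[OF N.base] by simp
next
  case (add a f b g)
  have "opH k (\<lambda>w. f w + g w) = (\<lambda>w. opH k f w + opH k g w)" by (auto simp: opH_def algebra_simps)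
  thus ?case using N.add[OF add.IH] rho_add[OF hh_in_sl[OF k]] by simp
next
  case (smult a f t)
  have "opH k (\<lambda>w. t * f w) = (\<lambda>w. t * opH k f w)" by (auto simp: opH_def algebra_simps)
  thus ?case using N.smult[OF smult.IH] rho_scale[OF hh_in_sl[OF k]] by simp
next
  case (lower l a f)
  have "opH k (opF l f) = (\<lambda>w. opF l (opH k f) w + (- alpha l (hh k)) * opF l f w)"
    using commutator_opH_opF[OF k lower.hyps(1)] by (auto simp: fun_eq_iff)
  thus ?case unfolding cartan_f_commute[OF hh_in_cartan[OF k] lower.hyps(1)]
    by (simp only:) (rule N.add[OF N.lower[OF lower.hyps(1) lower.IH] N.smult[OF N.lower[OF lower.hyps]]])
qed

lemma up_v0_notin_S: "k \<in> {1..n} \<Longrightarrow> i \<in> {1..k} \<Longrightarrow> shift v0 k i 1 \<notin> S"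
  unfolding up_in_S_iff[OF v0_in_S] by (simp add: v0_def)

text \<open>\<open>N\<close> is generated by lowering alone. Moving \<open>ee k\<close> past an
  \<open>ff l\<close> costs at most a weight term, already in \<open>N\<close>, and at the bottom
  both highest weight vectors are killed.\<close>

lemma N_raise:
  assumes k: "k \<in> {1..n}"
  shows "N a f \<Longrightarrow> N (\<rho> (ee k) a) (opE k f)"
proof (induction rule: N.induct)
  case base
  have "ee k \<in> nplus n" using ee_in_sl[OF k] by (auto simp: nplus_def ee_def Eu_def)
  hence "\<rho> (ee k) x = 0" by (rule killed)
  moreover have "opE k (unit_fun v0) = (\<lambda>w. 0)"
    using up_v0_notin_S[OF k] by (auto simp: opE_unit_fun fun_eq_iff)
  ultimately show ?case using N_zero by simp
next
  case (add a f b g)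
  thus ?case using N.add[OF add.IH] rho_add[OF ee_in_sl[OF k]] by (simp add: opE_add)
next
  case (smult a f t)
  thus ?case using N.smult[OF smult.IH] rho_scale[OF ee_in_sl[OF k]] by (simp add: opE_smult)
next
  case (lower l a f)
  have eq: "opE k (opF l f) = (\<lambda>w. opF l (opE k f) w + (if k = l then opH k f w else 0))"
    using commutator_opE_opF[OF N_supp[OF lower.hyps(2)] k lower.hyps(1)] by (auto simp: fun_eq_iff)
  have "N (if k = l then \<rho> (hh k) a else 0) (\<lambda>w. if k = l then opH k f w else 0)"
    using N_weight_op[OF k lower.hyps(2)] N_zero by auto
  thus ?case unfolding ef_commute[OF k lower.hyps(1)] eq
    by (rule N.add[OF N.lower[OF lower.hyps(1) lower.IH]])
qed

text \<open>This ties the two components together: the top eigencomponent of \<open>a\<close> is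
  governed by \<open>f v0\<close>, since lowering pushes all components down by one and never
  reaches \<open>v0\<close>.\<close>

lemma N_graded:
  defines "\<mu> \<equiv> wt_fun n c (grading_elt n)"
  shows "N a f \<Longrightarrow> \<exists>y D. a = (\<Sum>j\<le>D. y j) \<and> y 0 = scale (f v0) x \<and> (\<forall>j>D. y j = 0) \<and>
      (\<forall>j. \<rho> (grading_elt n) (y j) = scale (\<mu> - of_nat j) (y j))"
proof (induction rule: N.induct)
  case base
  have H: "grading_elt n \<in> sl n" using grading_elt_in_cartan cartan_subset_sl by blast
  show ?case
    using weight[OF grading_elt_in_cartan] rho_zero[OF H]
    by (intro exI[of _ "\<lambda>j::nat. if j = 0 then x else 0"] exI[of _ 0]) (auto simp: unit_fun_def \<mu>_def)
next
  case (add a f b g)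
  have H: "grading_elt n \<in> sl n" using grading_elt_in_cartan cartan_subset_sl by blast
  obtain y D where y: "a = (\<Sum>j\<le>D. y j)" "y 0 = scale (f v0) x" "\<forall>j>D. y j = 0"
      "\<forall>j. \<rho> (grading_elt n) (y j) = scale (\<mu> - of_nat j) (y j)" using add.IH(1) by blast
  obtain z C where z: "b = (\<Sum>j\<le>C. z j)" "z 0 = scale (g v0) x" "\<forall>j>C. z j = 0"
      "\<forall>j. \<rho> (grading_elt n) (z j) = scale (\<mu> - of_nat j) (z j)" using add.IH(2) by blast
  have "a = (\<Sum>j\<le>max D C. y j)" unfolding y(1) using y(3) by (intro sum.mono_neutral_left) auto
  moreover have "b = (\<Sum>j\<le>max D C. z j)" unfolding z(1) using z(3) by (intro sum.mono_neutral_left) auto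
  ultimately show ?case using y(2-) z(2-)
    by (intro exI[of _ "\<lambda>j. y j + z j"] exI[of _ "max D C"])
      (auto simp: sum.distrib rho_add[OF H] vs.scale_right_distrib vs.scale_left_distrib)
next
  case (smult a f t)
  have H: "grading_elt n \<in> sl n" using grading_elt_in_cartan cartan_subset_sl by blast
  obtain y D where "a = (\<Sum>j\<le>D. y j)" "y 0 = scale (f v0) x" "\<forall>j>D. y j = 0"
      "\<forall>j. \<rho> (grading_elt n) (y j) = scale (\<mu> - of_nat j) (y j)" using smult.IH by blast
  thus ?case
    by (intro exI[of _ "\<lambda>j. scale t (y j)"] exI[of _ D]) (auto simp: vs.scale_sum_right rho_scale[OF H] mult.commute)
next
  case (lower k a f)
  have H: "grading_elt n \<in> sl n" using grading_elt_in_cartan cartan_subset_sl by blast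
  note k = lower.hyps(1)
  obtain y D where y: "a = (\<Sum>j\<le>D. y j)" "\<forall>j>D. y j = 0"
      "\<forall>j. \<rho> (grading_elt n) (y j) = scale (\<mu> - of_nat j) (y j)" using lower.IH by blast
  \<comment> \<open>The value 0 at index 0 records that lowering produces nothing in the top
    eigenspace, matching \<open>opF k f v0 = 0\<close>.\<close>
  define z where "z j = (case j of 0 \<Rightarrow> 0 | Suc j \<Rightarrow> \<rho> (ff k) (y j))" for j
  have fsum: "\<rho> (ff k) (\<Sum>j\<in>A. y j) = (\<Sum>j\<in>A. \<rho> (ff k) (y j))" if "finite A" for A
    using that by (induction A rule: finite_induct) (auto simp: rho_add rho_zero ff_in_sl[OF k])
  have "opF k f v0 = 0"
    using N_supp[OF lower.hyps(2)] up_v0_notin_S[OF k] by (auto simp: opF_def intro!: sum.neutral)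
  moreover have "\<rho> (ff k) a = (\<Sum>j\<le>Suc D. z j)"
    unfolding y(1) fsum[OF finite_atMost] by (subst sum.atMost_Suc_shift) (simp add: z_def)
  moreover have "\<rho> (grading_elt n) (z j) = scale (\<mu> - of_nat j) (z j)" for j
  proof (cases j)
    case 0
    thus ?thesis by (simp add: z_def rho_zero[OF H])
  next
    case (Suc i)
    have "\<rho> (grading_elt n) (z j) = scale (\<mu> - of_nat i) (\<rho> (ff k) (y i)) + scale (- 1) (\<rho> (ff k) (y i))"
      using y(3) by (simp add: Suc z_def cartan_f_commute[OF grading_elt_in_cartan k] alpha_grading_elt[OF k]
          rho_scale[OF ff_in_sl[OF k]])
    also have "\<dots> = scale (\<mu> - of_nat j) (z j)"
      unfolding vs.scale_left_distrib[symmetric] by (simp add: Suc z_def algebra_simps)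
    finally show ?thesis .
  qed
  moreover have "\<forall>j>Suc D. z j = 0"
    using y(2) by (auto simp: z_def rho_zero[OF ff_in_sl[OF k]] split: nat.splits)
  ultimately show ?case
    by (intro exI[of _ z] exI[of _ "Suc D"]) (auto simp: z_def)
qed

lemma N_zero_left_at_v0:
  assumes "N 0 f"
  shows "f v0 = 0"
proof -
  have H: "grading_elt n \<in> sl n" using grading_elt_in_cartan cartan_subset_sl by blast
  obtain y D where y: "0 = (\<Sum>j\<le>D. y j)" "y 0 = scale (f v0) x"
      "\<forall>j. \<rho> (grading_elt n) (y j) = scale (wt_fun n c (grading_elt n) - of_nat j) (y j)"
    using N_graded[OF assms] by blast
  have "y 0 = 0"
    by (rule eigenvectors_sum_zero[OF vs.vector_space_axioms rho_add[OF H] rho_scale[OF H], where D = D])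
      (use y in auto)
  thus ?thesis using y(2) x0 by simp
qed

text \<open>The \<open>f\<close> with \<open>N 0 f\<close> are stable under raising. A nonzero one
  whose maximal depth is least possible is killed by every \<open>opE k\<close>, hence supported on
  \<open>v0\<close>, where it vanishes by the grading.\<close>

lemma N_zero_left:
  assumes "N 0 f"
  shows "f w = 0"
proof (rule ccontr)
  assume "f w \<noteq> 0"
  define P where "P f \<longleftrightarrow> N 0 f \<and> (\<exists>w. f w \<noteq> 0)" for f
  define D where "D f = Max ((\<lambda>v. nat (depth v)) ` {v. f v \<noteq> 0})" for f :: "gtarr \<Rightarrow> complex"
  have "P f" using assms \<open>f w \<noteq> 0\<close> by (auto simp: P_def)
  then obtain g where g: "P g" and min: "\<And>h. P h \<Longrightarrow> D g \<le> D h"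
    using ex_has_least_nat[of P f D] by blast
  have Ng: "N 0 g" using g by (simp add: P_def)
  have le: "nat (depth v) \<le> D g" if "g v \<noteq> 0" for v
    unfolding D_def by (rule Max_ge) (use N_finite[OF Ng] that in auto)
  have ker: "opE k g w = 0" if k: "k \<in> {1..n}" for k w
  proof (rule ccontr)
    assume w: "opE k g w \<noteq> 0"
    have NE: "N 0 (opE k g)" using N_raise[OF k Ng] rho_zero[OF ee_in_sl[OF k]] by simp
    hence "D g \<le> D (opE k g)" using w by (intro min) (auto simp: P_def)
    moreover have "D (opE k g) \<in> (\<lambda>v. nat (depth v)) ` {v. opE k g v \<noteq> 0}"
      unfolding D_def by (rule Max_in) (use N_finite[OF NE] w in auto)
    then obtain v where v: "opE k g v \<noteq> 0" "D (opE k g) = nat (depth v)" by auto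
    obtain i where i: "i \<in> {1..k}" "g (shift v k i (-1)) \<noteq> 0"
      using v(1) by (auto simp: opE_def split: if_splits elim!: sum.not_neutral_contains_not_neutral)
    have vS: "v \<in> S" using v(1) by (auto simp: opE_def split: if_splits)
    have "nat (depth (shift v k i (-1))) = nat (depth v) + 1"
      using depth_down[OF k i(1), of v] depth_nonneg[OF vS] by simp
    hence "nat (depth v) < D g" using le[OF i(2)] by simp
    ultimately show False using v(2) by simp
  qed
  obtain u where u: "g u \<noteq> 0" using g by (auto simp: P_def)
  have "u = v0" by (rule opE_kernel[OF N_supp[OF Ng] ker u])
  thus False using u N_zero_left_at_v0[OF Ng] by simp
qed

text \<open>These \<open>a\<close> form a submodule of a simple module. It cannot contain
  \<open>x\<close>, for then the pair of 0 and \<open>unit_fun v0\<close> would lie in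
  \<open>N\<close>.\<close>

lemma N_zero_right:
  assumes "N a (\<lambda>w. 0)"
  shows "a = 0"
proof -
  define W where "W = {a. N a (\<lambda>w. 0)}"
  have E0: "opE k (\<lambda>w. 0) = (\<lambda>w. 0)" "opF k (\<lambda>w. 0) = (\<lambda>w. 0)" for k
    by (auto simp: opE_def opF_def)
  have sub: "vs.subspace W"
    unfolding vs.subspace_def W_def
    using N_zero N.add[of _ "\<lambda>w. 0" _ "\<lambda>w. 0"] N.smult[of _ "\<lambda>w. 0"] by auto
  have "\<rho> X w \<in> W" if "X \<in> sl n" "w \<in> W" for X w
  proof (rule chevalley_stable_imp_stable[OF lm n sub _ that])
    fix k w assume k: "k \<in> {1..n}" "w \<in> W"
    thus "\<rho> (ee k) w \<in> W \<and> \<rho> (ff k) w \<in> W"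
      using N_raise[OF k(1), of w "\<lambda>w. 0"] N.lower[OF k(1), of w "\<lambda>w. 0"] by (simp add: W_def E0)
  qed
  hence "W = {0} \<or> W = UNIV" using simple sub by (simp add: simple_module_def)
  moreover have "x \<notin> W"
  proof
    assume "x \<in> W"
    hence "N (x - x) (\<lambda>w. unit_fun v0 w - 0)" unfolding W_def by (intro N_diff N.base) simp
    hence "unit_fun v0 v0 = 0" using N_zero_left[of "unit_fun v0"] by simp
    thus False by (simp add: unit_fun_def)
  qed
  ultimately have "W = {0}" by blast
  thus ?thesis using assms by (auto simp: W_def)
qed

lemma N_left_unique: "N a f \<Longrightarrow> N b f \<Longrightarrow> a = b"
  using N_zero_right[of "a - b"] N_diff[of a f b f] by simp

lemma N_right_unique: "N a f \<Longrightarrow> N a g \<Longrightarrow> f = g"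
proof
  fix w assume "N a f" "N a g"
  hence "N 0 (\<lambda>w. f w - g w)" using N_diff[of a f a g] by simp
  from N_zero_left[OF this, of w] show "f w = g w" by simp
qed

lemma N_left_total: "\<exists>f. N a f"
proof -
  define W where "W = {a. \<exists>f. N a f}"
  have sub: "vs.subspace W"
    unfolding vs.subspace_def W_def by (auto intro: N_zero N.add N.smult)
  have "\<rho> X w \<in> W" if "X \<in> sl n" "w \<in> W" for X w
    by (rule chevalley_stable_imp_stable[OF lm n sub _ that]) (unfold W_def, blast intro: N_raise N.lower)
  hence "W = {0} \<or> W = UNIV" using simple sub by (simp add: simple_module_def)
  moreover have "x \<in> W" using N.base by (auto simp: W_def)
  ultimately show ?thesis using x0 by (auto simp: W_def)
qed

lemma N_right_total: "v \<in> S \<Longrightarrow> \<exists>a. N a (unit_fun v)"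
proof -
  assume "v \<in> S"
  hence "unit_fun v \<in> {f. \<exists>a. N a f}"
  proof (rule unit_fun_generated[where U = "{f. \<exists>a. N a f}", rotated 4])
    show "unit_fun v0 \<in> {f. \<exists>a. N a f}" using N.base by blast
    show "(\<lambda>w. f w + g w) \<in> {f. \<exists>a. N a f}" if "f \<in> {f. \<exists>a. N a f}" "g \<in> {f. \<exists>a. N a f}" for f g
      using that N.add by blast
    show "(\<lambda>w. t * f w) \<in> {f. \<exists>a. N a f}" if "f \<in> {f. \<exists>a. N a f}" for t f
      using that N.smult by blast
    show "opF k f \<in> {f. \<exists>a. N a f}" if "k \<in> {1..n}" "f \<in> {f. \<exists>a. N a f}" for k f
      using that N.lower by blast
  qed
  thus ?thesis by simp
qed

section \<open>The basis transported from the model\<close>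

definition T :: "gtarr \<Rightarrow> 'v" where
  "T v = (THE a. N a (unit_fun v))"

lemma N_T: "v \<in> S \<Longrightarrow> N (T v) (unit_fun v)"
  unfolding T_def by (rule theI') (use N_right_total N_left_unique in blast)

lemma N_scaled_T0:
  "N (scale t (if v \<in> S then T v else 0)) (\<lambda>w. t * (if v \<in> S then unit_fun v w else 0))"
proof (cases "v \<in> S")
  case True
  thus ?thesis using N.smult[OF N_T[OF True]] by simp
qed (simp add: N_zero)

lemma N_combination:
  assumes "finite A" "A \<subseteq> S"
  shows "N (\<Sum>v\<in>A. scale (r v) (T v)) (\<lambda>w. \<Sum>v\<in>A. r v * unit_fun v w)"
  by (rule N_sum[OF assms(1)], rule N.smult, rule N_T) (use assms(2) in blast)

lemma sum_unit_fun: "finite A \<Longrightarrow> (\<Sum>v\<in>A. r v * unit_fun v w) = (if w \<in> A then r w else 0)"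
proof -
  assume "finite A"
  have "(\<Sum>v\<in>A. r v * unit_fun v w) = (\<Sum>v\<in>A. if v = w then r w else 0)"
    by (rule sum.cong) (auto simp: unit_fun_def)
  thus ?thesis using \<open>finite A\<close> by simp
qed

lemma inj_T: "inj_on T S"
proof (rule inj_onI)
  fix v w assume "v \<in> S" "w \<in> S" "T v = T w"
  hence "unit_fun v = unit_fun w" using N_T[of v] N_T[of w] N_right_unique by metis
  from fun_cong[OF this, of v] show "v = w" by (auto simp: unit_fun_def split: if_splits)
qed

lemma independent_T: "\<not> vs.dependent (T ` S)"
proof
  assume "vs.dependent (T ` S)"
  then obtain B r where B: "finite B" "B \<subseteq> T ` S" "(\<Sum>b\<in>B. scale (r b) b) = 0" "\<exists>b\<in>B. r b \<noteq> 0"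
    unfolding vs.dependent_explicit by blast
  obtain A where A: "A \<subseteq> S" "finite A" "B = T ` A" using finite_subset_image[OF B(1,2)] by blast
  have "(\<Sum>b\<in>B. scale (r b) b) = (\<Sum>v\<in>A. scale (r (T v)) (T v))"
    unfolding A(3) using inj_on_subset[OF inj_T A(1)] by (simp add: sum.reindex)
  hence N0: "N 0 (\<lambda>w. \<Sum>v\<in>A. r (T v) * unit_fun v w)"
    using N_combination[OF A(2,1), of "\<lambda>v. r (T v)"] B(3) by simp
  have "r (T v) = 0" if "v \<in> A" for v
    using N_zero_left[OF N0, of v] that by (simp add: sum_unit_fun[OF A(2)])
  thus False using B(4) A(3) by auto
qed

lemma span_T: "vs.span (T ` S) = UNIV"
proof -
  have "a \<in> vs.span (T ` S)" for a
  proof -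
    obtain f where f: "N a f" using N_left_total by blast
    define A where "A = {v. f v \<noteq> 0}"
    have A: "finite A" "A \<subseteq> S" using N_finite[OF f] N_supp[OF f] by (auto simp: A_def)
    have "(\<lambda>w. \<Sum>v\<in>A. f v * unit_fun v w) = f"
      unfolding sum_unit_fun[OF A(1)] by (auto simp: A_def)
    hence "N (\<Sum>v\<in>A. scale (f v) (T v)) f" using N_combination[OF A, of f] by simp
    hence "a = (\<Sum>v\<in>A. scale (f v) (T v))" by (rule N_left_unique[OF f])
    also have "\<dots> \<in> vs.span (T ` S)"
      using A(2) by (intro vs.span_sum vs.span_scale vs.span_base) auto
    finally show ?thesis .
  qed
  thus ?thesis by blast
qed

text \<open>Both sides of each formula are related by \<open>N\<close> to the same function of the
  model, so they coincide by uniqueness of the first component.\<close>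

lemma strongly_tame: "strongly_tame_GT n scale \<rho>"
  unfolding strongly_tame_GT_def Let_def
proof (intro exI[of _ S] exI[of _ T] conjI ballI)
  show "S \<subseteq> gt_arrays n" by (auto simp: S_def)
  fix k v assume k: "k \<in> {1..n}" and v: "v \<in> S"
  have "N (- (\<Sum>i=1..k. scale (coefE v k i) (if shift v k i 1 \<in> S then T (shift v k i 1) else 0))) (opE k (unit_fun v))"
  proof -
    have "N (\<Sum>i=1..k. scale (coefE v k i) (if shift v k i 1 \<in> S then T (shift v k i 1) else 0))
      (\<lambda>w. \<Sum>i=1..k. coefE v k i * (if shift v k i 1 \<in> S then unit_fun (shift v k i 1) w else 0))"
      by (intro N_sum N_scaled_T0) auto
    from N.smult[OF this, of "-1"] show ?thesis by (simp add: opE_unit_fun[abs_def])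
  qed
  thus "\<rho> (ee k) (T v) = - (\<Sum>i=1..k. scale (coefE v k i) (if shift v k i 1 \<in> S then T (shift v k i 1) else 0))"
    using N_raise[OF k N_T[OF v]] N_left_unique by blast
  have "N (\<Sum>i=1..k. scale (coefF v k i) (if shift v k i (-1) \<in> S then T (shift v k i (-1)) else 0)) (opF k (unit_fun v))"
    unfolding opF_unit_fun[abs_def] by (intro N_sum N_scaled_T0) auto
  thus "\<rho> (ff k) (T v) = (\<Sum>i=1..k. scale (coefF v k i) (if shift v k i (-1) \<in> S then T (shift v k i (-1)) else 0))"
    using N.lower[OF k N_T[OF v]] N_left_unique by blast
  have "opH k (unit_fun v) = (\<lambda>w. gt_weight k v * unit_fun v w)"
    by (auto simp: opH_def unit_fun_def)
  hence "N (scale (gt_weight k v) (T v)) (opH k (unit_fun v))"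
    using N.smult[OF N_T[OF v]] by simp
  thus "\<rho> (hh k) (T v) = scale (2 * (\<Sum>i=1..k. v k i) - (\<Sum>i=1..k-1. v (k-1) i) - (\<Sum>i=1..k+1. v (k+1) i) - 1) (T v)"
    using N_weight_op[OF k N_T[OF v]] N_left_unique unfolding gt_weight_def by blast
qed (rule inj_T independent_T span_T)+

end

section \<open>Arithmetic of admissible weights\<close>

text \<open>If a difference of coordinates is an integer, coprimality forces \<open>q\<close> to
  divide the pairing of \<open>\<eta>\<close> with the root. By \<open>condC\<close> that pairing is
  then 0 or \<open>q\<close>, according to whether the root stays positive under \<open>s\<close>,
  and in both cases the difference is positive.\<close>

lemma admissible_dominant:
  assumes "n \<ge> 1" "q > 0" "coprime p q" "admissible n p q c"
  shows "dominant_row n (eps_coords n (\<lambda>j. c j + 1))"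
proof
  obtain \<mu> s \<eta> where mu: "(\<Sum>i=1..n. \<mu> i) + n + 1 \<le> p" and s: "s permutes idx n" and C: "condC n q s \<eta>"
    and c: "\<forall>i\<in>{1..n}. c i = dot_act n s (\<lambda>j. of_nat (\<mu> j) - (of_nat p / of_nat q) * of_int (\<eta> j)) i"
    using assms(4) unfolding admissible_def by blast
  define g where "g = eps_coords n (\<lambda>j. of_nat (\<mu> j) - (of_nat p / of_nat q) * of_int (\<eta> j) + 1)"
  let ?m = "eps_coords n (\<lambda>j. c j + 1)"
  define M where "M a b = (\<Sum>l=a..<b. int (\<mu> l) + 1)" for a b
  define e where "e a b = (\<Sum>l=a..<b. \<eta> l)" for a b
  \<comment> \<open>Here \<open>g\<close> holds the coordinates before the Weyl group element acts.
    The subtracted constant normalizes the last coordinate to 0 and drops out of all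
    differences.\<close>
  have m: "?m a = g (inv s a) - g (inv s (n + 1))" if "1 \<le> a" "a \<le> n + 1" for a
  proof -
    have "?m a = (\<Sum>i=a..n. g (inv s i) - g (inv s (Suc i)))"
      unfolding eps_coords_def using that c by (intro sum.cong refl) (auto simp: dot_act_def weyl_act_def g_def)
    also have "\<dots> = g (inv s a) - g (inv s (Suc n))"
      using that sum_Suc_diff[of a n "\<lambda>i. - g (inv s i)"] by simp
    finally show ?thesis by simp
  qed
  have gdiff: "g a - g b = of_int (M a b) - (of_nat p / of_nat q) * of_int (e a b)" if "a < b" "b \<le> n + 1" for a b
  proof -
    have "{a..n} = {a..<b} \<union> {b..n}" using that by auto
    hence "g a = (\<Sum>j=a..<b. of_nat (\<mu> j) - (of_nat p / of_nat q) * of_int (\<eta> j) + 1) + g b"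
      unfolding g_def eps_coords_def by (simp only:) (subst sum.union_disjoint, auto)
    thus ?thesis by (simp add: M_def e_def sum.distrib sum_subtractf sum_distrib_left)
  qed
  have int_eq: "int q dvd e a b \<and> int q * d = int q * M a b - int p * e a b"
    if "a < b" "b \<le> n + 1" "g a - g b = of_int d" for a b d
  proof -
    have "of_int d = of_int (M a b) - (of_nat p / of_nat q) * (of_int (e a b) :: complex)"
      using gdiff[OF that(1,2)] that(3) by simp
    hence "of_int (int q * d) = (of_int (int q * M a b - int p * e a b) :: complex)"
      using assms(2) by (simp add: field_simps)
    hence eq: "int q * d = int q * M a b - int p * e a b" by (simp only: of_int_eq_iff)
    hence "int p * e a b = int q * (M a b - d)" by (simp add: algebra_simps)
    hence "int q dvd int p * e a b" by simp
    moreover have "coprime (int q) (int p)" using assms(3) by (simp add: coprime_commute)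
    ultimately show ?thesis using eq by (simp add: coprime_dvd_mult_right_iff)
  qed
  fix i j assume ij: "1 \<le> i" "i < j" "j \<le> n + 1" and rp: "rp (?m i) = rp (?m j)"
  define a b where "a = inv s i" and "b = inv s j"
  have sab: "s a = i" "s b = j" using s by (simp_all add: a_def b_def permutes_inverses)
  have ab: "a \<in> idx n" "b \<in> idx n"
    using permutes_in_image[OF permutes_inv[OF s]] ij by (auto simp: a_def b_def idx_def)
  define d where "d = ip (?m i) - ip (?m j)"
  have gd: "g a - g b = of_int d"
    using rp_eq_imp_diff[OF rp] m[of i] m[of j] ij by (simp add: d_def a_def b_def)
  have "a \<noteq> b" using sab ij by auto
  then consider "a < b" | "b < a" by linarith
  hence "d > 0"
  proof cases
    case 1
    have b: "0 \<le> e a b" "e a b \<le> int q - 1"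
      using C[unfolded condC_def, rule_format, of a b] 1 ab sab ij by (auto simp: e_def idx_def)
    have *: "int q dvd e a b" "int q * d = int q * M a b - int p * e a b"
      using int_eq[OF 1 _ gd] ab by (auto simp: idx_def)
    have "e a b = 0" using b *(1) zdvd_imp_le[of "int q" "e a b"] by linarith
    hence "d = M a b" using *(2) assms(2) by simp
    moreover have "M a b > 0" unfolding M_def using 1 by (intro sum_pos) auto
    ultimately show ?thesis by simp
  next
    case 2
    have b: "1 \<le> e b a" "e b a \<le> int q"
      using C[unfolded condC_def, rule_format, of b a] 2 ab sab ij by (auto simp: e_def idx_def)
    have "g b - g a = of_int (- d)" using gd by (simp add: algebra_simps)
    hence *: "int q dvd e b a" "int q * (- d) = int q * M b a - int p * e b a"
      using int_eq[OF 2 _ , of "- d"] ab by (auto simp: idx_def)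
    have "e b a = int q" using b *(1) zdvd_imp_le[of "int q" "e b a"] by linarith
    hence "int q * (- d) = int q * (M b a - int p)" using *(2) by (simp add: algebra_simps)
    hence "d = int p - M b a" using assms(2) unfolding mult_cancel_left by simp
    \<comment> \<open>The level bound enters here: the pairing of the rho-shifted weight with any
      positive root is at most the sum of the labels plus \<open>n\<close>, hence below
      \<open>p\<close>.\<close>
    moreover have "M b a \<le> (\<Sum>l=1..n. int (\<mu> l) + 1)"
      unfolding M_def using ab by (intro sum_mono2) (auto simp: idx_def)
    hence "M b a \<le> int (\<Sum>l=1..n. \<mu> l) + int n" by (simp add: sum.distrib)
    hence "M b a < int p" using mu by linarith
    ultimately show ?thesis by simp
  qed
  thus "ip (?m j) < ip (?m i)" by (simp add: d_def)
qed (rule assms(1))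

lemma admissible_strongly_tame:
  assumes "n \<ge> 1" "q > 0" "coprime p q" "admissible n p q c"
    and hw: "simple_hw_module n scale \<rho> (nplus n) (wt_fun n c)"
  shows "strongly_tame_GT n scale \<rho>"
proof -
  interpret dominant_row n "eps_coords n (\<lambda>j. c j + 1)"
    by (rule admissible_dominant[OF assms(1-4)])
  obtain x where x: "x \<noteq> 0" "\<And>X. X \<in> nplus n \<Longrightarrow> \<rho> X x = 0" "\<And>H. H \<in> cartan n \<Longrightarrow> \<rho> H x = scale (wt_fun n c H) x"
    using hw unfolding simple_hw_module_def by blast
  interpret gt_highest_weight n "eps_coords n (\<lambda>j. c j + 1)" scale \<rho> c x
  proof
    show "simple_module n scale \<rho>" using hw by (simp add: simple_hw_module_def)
    show "c k = eps_coords n (\<lambda>j. c j + 1) k - eps_coords n (\<lambda>j. c j + 1) (k+1) - 1" if "k \<in> {1..n}" for k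
      using that by (simp add: eps_coords_def sum.atLeast_Suc_atMost)
  qed (use x in auto)
  show ?thesis by (rule strongly_tame)
qed

theorem mainTheorem14:
  fixes n p q :: nat and k :: rat and c :: "nat \<Rightarrow> complex"
    and scale :: "complex \<Rightarrow> 'v::ab_group_add \<Rightarrow> 'v" and \<rho> :: "mat \<Rightarrow> 'v \<Rightarrow> 'v"
  assumes "n \<ge> 1"
    and "p > 0" and "q > 0" and "coprime p q" and "p \<ge> n + 1"
    and "k + of_nat n + 1 = of_nat p / of_nat q"
    and "admissible n p q c"
  shows "(simple_hw_module n scale \<rho> (nplus n) (wt_fun n c) \<longrightarrow> strongly_tame_GT n scale \<rho>) \<and>
    (\<forall>u\<in>Wbar n. simple_hw_module n scale \<rho> (u ` nplus n) (hstar_act n u (wt_fun n c)) \<longrightarrow>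
        strongly_tame_GT_base n scale \<rho> (\<lambda>i. hstar_act n u (alpha i)))"
proof (intro conjI ballI impI)
  assume "simple_hw_module n scale \<rho> (nplus n) (wt_fun n c)"
  thus "strongly_tame_GT n scale \<rho>"
    by (rule admissible_strongly_tame[OF assms(1,3,4,7)])
next
  fix u assume u: "u \<in> Wbar n"
    and "simple_hw_module n scale \<rho> (u ` nplus n) (hstar_act n u (wt_fun n c))"
  hence "simple_hw_module n scale (\<lambda>X. \<rho> (u X)) (nplus n) (wt_fun n c)"
    by - (rule simple_hw_module_twist[OF lie_aut_Wbar[OF u]])
  hence "strongly_tame_GT n scale (\<lambda>X. \<rho> (u X))"
    by (rule admissible_strongly_tame[OF assms(1,3,4,7)])
  thus "strongly_tame_GT_base n scale \<rho> (\<lambda>i. hstar_act n u (alpha i))"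
    unfolding strongly_tame_GT_base_def using u by blast
qed

end
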